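(* Let $N\geq 3$ be an integer and let $k\in\{1,2,\ldots,[N/2]\}$ if $N$ is odd, or $k\in\{1,2,\ldots,[N/2]-1\}$ if $N$ is even. Let $p,q:[0,\infty)\to(0,\infty)$ and $f,g:[0,\infty)\times[0,\infty)\to[0,\infty)$ be continuous functions such that: (i) $r^{N+\frac{N}{k}-2}\left[p^{k}(r)+q^{k}(r)\right]$ is nondecreasing for large $r$; (ii) $f,g$ are monotone non-decreasing in each variable, $f(0,0)=g(0,0)=0$, and $f(s,t)>0$, $g(s,t)>0$ for all $s,t>0$; (iii) $\displaystyle\int_{1}^{\infty}\frac{1}{\sqrt[k+1]{(k+1)F(t)}}\,dt=\infty$, where $F(t)=\int_{0}^{t}\left(f^{k}(z,z)+g^{k}(z,z)\right)dz$. If there exists a positive number $\varepsilon$ such that $$\int_{0}^{\infty}t^{1+\varepsilon+\frac{2(k-1)}{k+1}}\left(p^{k}(t)+q^{k}(t)\right)^{\frac{2}{k+1}}dt<\infty,$$ then the system $$\begin{cases}S_{k}^{1/k}\left(\lambda\left(D^{2}u\right)\right)=p(|x|)\,f(u,v)&\text{in }\mathbb{R}^{N},\\ S_{k}^{1/k}\left(\lambda\left(D^{2}v\right)\right)=q(|x|)\,g(u,v)&\text{in }\mathbb{R}^{N}\end{cases}$$ has a nonnegative nontrivial radial bounded solution $(u,v)\in\Phi^{k}(\mathbb{R}^{N})\times\Phi^{k}(\mathbb{R}^{N})$.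
   Context: $[\cdot]$ denotes the integer part. For a $C^{2}$ function $u$ on $\mathbb{R}^{N}$, $D^{2}u$ is its Hessian matrix and $\lambda(D^{2}u)=(\lambda_{1},\ldots,\lambda_{N})$ is the vector of eigenvalues of $D^{2}u$. For $j=1,\ldots,N$, $S_{j}(\lambda)=\sum_{1\leq i_{1}<\cdots<i_{j}\leq N}\lambda_{i_{1}}\cdots\lambda_{i_{j}}$ is the $j$-th elementary symmetric polynomial, and $S_{k}^{1/k}$ denotes $(S_k)^{1/k}$. The Gårding open cone is $\Gamma_{k}(N)=\{\lambda\in\mathbb{R}^{N} : S_{1}(\lambda)>0,\ldots,S_{k}(\lambda)>0\}$, and the space of admissible (strictly $k$-convex) functions is $\Phi^{k}(\mathbb{R}^{N})=\{u\in C^{2}(\mathbb{R}^{N}) : \lambda(D^{2}u(x))\in\Gamma_{k}(N)\text{ for all }x\in\mathbb{R}^{N}\}$. "Nondecreasing for large $r$" means nondecreasing on $[R,\infty)$ for some $R>0$. A pair $(u,v)$ is radial, nonnegative or bounded if both components are (radial: depending only on $|x|$); "nontrivial" means $(u,v)\not\equiv(0,0)$. *)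

theory Defs
  imports "HOL-Analysis.Analysis"
begin

definition grad :: "(real^'n \<Rightarrow> real) \<Rightarrow> real^'n \<Rightarrow> real^'n::finite" where
  "grad u x = (\<chi> i. frechet_derivative u (at x) (axis i 1))"

text \<open>The entry in row \<open>i\<close> and column \<open>j\<close> is the partial derivative in direction \<open>j\<close> of the
  partial derivative of \<open>u\<close> in direction \<open>i\<close>.\<close>
definition hessian :: "(real^'n \<Rightarrow> real) \<Rightarrow> real^'n \<Rightarrow> real^'n^'n::finite" where
  "hessian u x = matrix (frechet_derivative (grad u) (at x))"

definition C2 :: "(real^'n::finite \<Rightarrow> real) \<Rightarrow> bool" where
  "C2 u \<longleftrightarrow> u differentiable_on UNIV \<and> grad u differentiable_on UNIV \<and>
     continuous_on UNIV (hessian u)"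

text \<open>The eigenvalues listed with algebraic multiplicity.  Such a list exists whenever the
  characteristic polynomial splits over the reals, in particular for every symmetric matrix, and
  is unique up to permutation; all functions of it used below are symmetric.\<close>
definition eigenvalues :: "real^'n^'n \<Rightarrow> real^'n::finite" where
  "eigenvalues A = (SOME l. \<forall>x. det (mat x - A) = (\<Prod>i\<in>UNIV. x - l $ i))"

definition elem_sym :: "nat \<Rightarrow> real^'n::finite \<Rightarrow> real" where
  "elem_sym j l = (\<Sum>I | card I = j. \<Prod>i\<in>I. l $ i)"

definition garding_cone :: "nat \<Rightarrow> (real^'n::finite) set" where
  "garding_cone k = {l. \<forall>j\<in>{1..k}. elem_sym j l > 0}"

definition admissible :: "nat \<Rightarrow> (real^'n::finite \<Rightarrow> real) set" where
  "admissible k = {u. C2 u \<and> (\<forall>x. eigenvalues (hessian u x) \<in> garding_cone k)}"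

definition radial :: "(real^'n::finite \<Rightarrow> real) \<Rightarrow> bool" where
  "radial u \<longleftrightarrow> (\<exists>\<phi>. \<forall>x. u x = \<phi> (norm x))"

end

theory Submission
  imports Defs
begin

text \<open>For a radial function \<open>u(x) = \<phi>(r)\<close> put \<open>G = \<phi>'/r\<close> and \<open>H = r G'\<close>.  The Hessian is the
  rank-one update \<open>G I + H e e\<^sup>T\<close> with \<open>e = x/r\<close>, so \<open>S\<^sub>k(\<lambda>(D\<^sup>2u)) = z(r)\<close> becomes the ordinary
  differential equation \<open>(r\<^sup>N G\<^sup>k)' = c r\<^bsup>N-1\<^esup> z\<close> with \<open>c = k / (N-1 choose k-1)\<close>: up to the factor
  \<open>c\<close>, \<open>G\<^sup>k\<close> is the mean \<open>r\<^bsup>-N\<^esup> \<integral>\<^sub>0\<^sup>r t\<^bsup>N-1\<^esup> z(t) dt\<close>, which is continuous at the origin.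

  The resulting integral system is solved by monotone iteration from \<open>u = v = 1/2\<close>.  Every iterate is
  a subsolution of the system evaluated at itself.  For subsolutions, multiplying the equations by
  \<open>r\<^bsup>N/k-1\<^esup> u'\<close> and \<open>r\<^bsup>N/k-1\<^esup> v'\<close> and integrating gives, with \<open>w = u + v\<close> and \<open>P = p\<^sup>k + q\<^sup>k\<close>,
  \<open>w' \<le> C h(r) ((k+1) F(w))\<^bsup>1/(k+1)\<^esup>\<close> where \<open>h(r)\<^bsup>k+1\<^esup> = r\<^bsup>k-1\<^esup> P(r)\<close>; hypothesis (i) is what makes the
  weight \<open>r\<^bsup>N+N/k-2\<^esup> P\<close> monotone up to a constant.  The integrability hypothesis makes \<open>h\<close> integrable
  on \<open>[0, \<infinity>)\<close>, so the divergence of the Keller-Osserman integral bounds \<open>w\<close> uniformly in \<open>r\<close> and along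
  the iteration.\<close>

subsection \<open>Eigenvalues of a rank-one update\<close>

text \<open>Vieta's formulas: expanding the product amounts to choosing the subset \<open>I\<close>
  of factors that contribute \<open>- l $ i\<close>, and the terms are collected by
  \<open>card I\<close>.\<close>

lemma prod_minus_eq_elem_sym:
  fixes l :: "real^'n::finite"
  shows "(\<Prod>i\<in>UNIV. x - l $ i)
       = (\<Sum>i\<le>CARD('n). (-1) ^ (CARD('n) - i) * elem_sym (CARD('n) - i) l * x ^ i)"
proof -
  let ?N = "CARD('n)"
  have "(\<Prod>i\<in>UNIV. x - l $ i) = (\<Prod>i\<in>UNIV. - (l $ i) + x)"
    by simp
  also have "\<dots> = (\<Sum>I\<in>Pow UNIV. (\<Prod>i\<in>I. - (l $ i)) * (\<Prod>i\<in>UNIV - I. x))"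
    by (rule prod_add) simp
  also have "\<dots> = (\<Sum>I\<in>UNIV. (-1) ^ card I * (\<Prod>i\<in>I. l $ i) * x ^ (?N - card I))"
    by (simp add: prod_uminus card_Diff_subset)
  also have "\<dots> = (\<Sum>j\<in>{..?N}. \<Sum>I\<in>{I\<in>UNIV. card I = j}.
      (-1) ^ card I * (\<Prod>i\<in>I. l $ i) * x ^ (?N - card I))"
    by (rule sum.group [symmetric]) (auto intro!: card_mono)
  also have "\<dots> = (\<Sum>j\<le>?N. (-1) ^ j * elem_sym j l * x ^ (?N - j))"
    by (auto simp: elem_sym_def sum_distrib_left sum_distrib_right intro!: sum.cong)
  also have "\<dots> = (\<Sum>i\<le>?N. (-1) ^ (?N - i) * elem_sym (?N - i) l * x ^ i)"
    by (rule sum.reindex_bij_witness [where i = "\<lambda>i. ?N - i" and j = "\<lambda>i. ?N - i"]) auto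
  finally show ?thesis .
qed

text \<open>Polynomial functions that agree everywhere have equal coefficients, and by Vieta these
  are the elementary symmetric values up to sign. Hence the arbitrary choice made in
  \<open>eigenvalues\<close> is harmless: any list with the right characteristic polynomial gives
  the same values.\<close>

lemma elem_sym_eqI:
  fixes l m :: "real^'n::finite"
  assumes "\<And>x. (\<Prod>i\<in>UNIV. x - l $ i) = (\<Prod>i\<in>UNIV. x - m $ i)"
  shows "elem_sym j l = elem_sym j m"
proof (cases "j \<le> CARD('n)")
  case True
  let ?c = "\<lambda>l::real^'n. \<lambda>i. (-1) ^ (CARD('n) - i) * elem_sym (CARD('n) - i) l"
  have "\<forall>x. (\<Sum>i\<le>CARD('n). ?c l i * x ^ i) = (\<Sum>i\<le>CARD('n). ?c m i * x ^ i)"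
    using assms unfolding prod_minus_eq_elem_sym by blast
  then have "\<forall>i\<le>CARD('n). ?c l i = ?c m i"
    unfolding polyfun_eq_coeffs .
  from this [rule_format, of "CARD('n) - j"] True show ?thesis
    by simp
next
  case False
  have "card I \<noteq> j" for I :: "'n set"
    using card_mono [of UNIV I] False by auto
  then show ?thesis
    by (simp add: elem_sym_def)
qed

text \<open>The index sets of size \<open>j\<close> are split by whether they contain
  \<open>a\<close>. Those avoiding \<open>a\<close> contribute \<open>g ^ j\<close> each; those
  containing it correspond to subsets of size \<open>j - 1\<close> of the remaining indices and
  contribute \<open>g ^ (j - 1) * b\<close>.\<close>

lemma elem_sym_two_values:
  fixes a :: "'n::finite"
  assumes "j \<ge> 1"
  shows "elem_sym j ((\<chi> i. if i = a then b else g) :: real^'n)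
       = real ((CARD('n) - 1) choose j) * g ^ j + real ((CARD('n) - 1) choose (j - 1)) * g ^ (j - 1) * b"
proof -
  let ?P = "\<lambda>I. \<Prod>i\<in>I. if i = a then b else g"
  let ?X = "{I :: 'n set. I \<subseteq> UNIV - {a} \<and> card I = j}" and ?Y = "{I :: 'n set. I \<subseteq> UNIV - {a} \<and> card I = j - 1}"
  have split: "{I :: 'n set. card I = j} = ?X \<union> insert a ` ?Y"
  proof (intro equalityI subsetI)
    fix I :: "'n set" assume I: "I \<in> {I. card I = j}"
    show "I \<in> ?X \<union> insert a ` ?Y"
    proof (cases "a \<in> I")
      case True
      then have "I = insert a (I - {a})" "I - {a} \<in> ?Y" using I by auto
      then show ?thesis by blast
    qed (use I in auto)
  next
    fix I :: "'n set" assume "I \<in> ?X \<union> insert a ` ?Y"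
    then show "I \<in> {I. card I = j}"
    proof
      assume "I \<in> insert a ` ?Y"
      then obtain J where "I = insert a J" "a \<notin> J" "card J = j - 1" by auto
      then show ?thesis using assms by simp
    qed auto
  qed
  have inj: "inj_on (insert a) ?Y"
    by (auto simp: inj_on_def)
  have "elem_sym j ((\<chi> i. if i = a then b else g) :: real^'n) = (\<Sum>I\<in>?X \<union> insert a ` ?Y. ?P I)"
    unfolding elem_sym_def split by simp
  also have "\<dots> = (\<Sum>I\<in>?X. ?P I) + (\<Sum>I\<in>?Y. ?P (insert a I))"
    using sum.reindex [OF inj, of ?P] by (subst sum.union_disjoint) (auto simp: o_def)
  also have "(\<Sum>I\<in>?X. ?P I) = (\<Sum>I\<in>?X. g ^ j)"
  proof (rule sum.cong [OF refl])
    fix I assume I: "I \<in> ?X"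
    then have "?P I = (\<Prod>i\<in>I. g)" by (intro prod.cong) auto
    then show "?P I = g ^ j" using I by simp
  qed
  also have "(\<Sum>I\<in>?Y. ?P (insert a I)) = (\<Sum>I\<in>?Y. g ^ (j - 1) * b)"
  proof (rule sum.cong [OF refl])
    fix I assume I: "I \<in> ?Y"
    then have "?P I = (\<Prod>i\<in>I. g)" by (intro prod.cong) auto
    moreover have "?P (insert a I) = b * ?P I" using I by (subst prod.insert) auto
    ultimately show "?P (insert a I) = g ^ (j - 1) * b" using I by simp
  qed
  finally show ?thesis
    by (simp add: n_subsets card_Diff_subset)
qed

text \<open>An orthogonal matrix whose column \<open>a\<close> is \<open>e\<close> conjugates the
  rank-one update to a diagonal matrix with \<open>G + H\<close> at position \<open>a\<close> and
  \<open>G\<close> elsewhere, and conjugation preserves the determinant.\<close>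

lemma det_rank_one_update:
  fixes e :: "real^'n::finite" and a :: 'n
  assumes "norm e = 1"
  shows "det (mat x - (mat G + (\<chi> i j. H * e $ i * e $ j)))
       = (\<Prod>i\<in>UNIV. x - (\<chi> i. if i = a then G + H else G) $ i)"
proof -
  obtain Q :: "real^'n^'n" where Q: "orthogonal_matrix Q" "Q *v axis a 1 = e"
    by (rule orthogonal_matrix_exists_basis [OF assms, of a])
  let ?D = "(\<chi> i j. if i = j then x - (if i = a then G + H else G) else 0) :: real^'n^'n"
  have e: "e $ i = Q $ i $ a" for i
    by (simp add: Q(2) [symmetric] matrix_vector_mult_basis column_def)
  have orth: "(\<Sum>k\<in>UNIV. Q $ i $ k * Q $ j $ k) = (if i = j then 1 else 0)" for i j
  proof -
    have "(Q ** transpose Q) $ i $ j = mat 1 $ i $ j"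
      using Q(1) by (simp add: orthogonal_matrix_def)
    then show ?thesis by (simp add: matrix_matrix_mult_def transpose_def mat_def)
  qed
  have "mat x - (mat G + (\<chi> i j. H * e $ i * e $ j)) = Q ** ?D ** transpose Q"
  proof -
    have "(Q ** ?D ** transpose Q) $ i $ j = (if i = j then x - G else 0) - H * e $ i * e $ j" for i j
    proof -
      have "(Q ** ?D ** transpose Q) $ i $ j
          = (\<Sum>k\<in>UNIV. Q $ i $ k * (x - (if k = a then G + H else G)) * Q $ j $ k)"
        by (simp add: matrix_matrix_mult_def transpose_def if_distrib [where f = "\<lambda>y. _ * y"] cong: if_cong)
      \<comment> \<open>The diagonal is separated into its scalar part \<open>x - G\<close>, summed
        by orthonormality of the rows, and the single correction \<open>- H\<close> at
        \<open>k = a\<close>.\<close>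
      also have "\<dots> = (\<Sum>k\<in>UNIV. (x - G) * (Q $ i $ k * Q $ j $ k) - (if k = a then H * Q $ i $ k * Q $ j $ k else 0))"
        by (intro sum.cong) (auto simp: algebra_simps)
      also have "\<dots> = (x - G) * (\<Sum>k\<in>UNIV. Q $ i $ k * Q $ j $ k) - H * Q $ i $ a * Q $ j $ a"
        by (simp add: sum_subtractf sum_distrib_left)
      finally show ?thesis by (simp add: orth e)
    qed
    then show ?thesis by (auto simp: vec_eq_iff mat_def)
  qed
  moreover have "det (Q ** ?D ** transpose Q) = det (Q ** transpose Q) * det ?D"
    by (simp add: det_mul)
  moreover have "Q ** transpose Q = mat 1"
    using Q(1) by (simp add: orthogonal_matrix_def)
  moreover have "det ?D = (\<Prod>i\<in>UNIV. x - (\<chi> i. if i = a then G + H else G) $ i)"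
    by (subst det_diagonal) auto
  ultimately show ?thesis by simp
qed

lemma elem_sym_eigenvalues_rank_one_update:
  fixes e :: "real^'n::finite"
  assumes "norm e = 1" and "j \<ge> 1"
  shows "elem_sym j (eigenvalues (mat G + (\<chi> i j. H * e $ i * e $ j)))
       = real ((CARD('n) - 1) choose j) * G ^ j + real ((CARD('n) - 1) choose (j - 1)) * G ^ (j - 1) * (G + H)"
proof -
  \<comment> \<open>An arbitrary position for the exceptional eigenvalue \<open>G + H\<close>; the
    explicit list \<open>?l\<close> then witnesses the property required by
    \<open>SOME\<close>.\<close>
  fix a :: 'n
  let ?A = "mat G + (\<chi> i j. H * e $ i * e $ j) :: real^'n^'n"
  let ?l = "(\<chi> i. if i = a then G + H else G) :: real^'n"
  have l: "\<forall>x. det (mat x - ?A) = (\<Prod>i\<in>UNIV. x - ?l $ i)"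
    using det_rank_one_update [OF assms(1)] by blast
  then have "\<forall>x. det (mat x - ?A) = (\<Prod>i\<in>UNIV. x - eigenvalues ?A $ i)"
    unfolding eigenvalues_def by (rule someI)
  with l have "elem_sym j (eigenvalues ?A) = elem_sym j ?l"
    by (intro elem_sym_eqI) metis
  then show ?thesis
    using elem_sym_two_values [OF assms(2)] by simp
qed

subsection \<open>Hessians of radial functions\<close>

lemma grad_eqI:
  fixes u :: "real^'n::finite \<Rightarrow> real"
  assumes "(u has_derivative (\<lambda>h. y \<bullet> h)) (at x)"
  shows "grad u x = y"
  unfolding grad_def frechet_derivative_at [OF assms, symmetric]
  by (simp add: vec_eq_iff inner_axis)

lemma hessian_eqI:
  fixes u :: "real^'n::finite \<Rightarrow> real"
  assumes "(grad u has_derivative (\<lambda>h. M *v h)) (at x)"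
  shows "hessian u x = M"
  unfolding hessian_def frechet_derivative_at [OF assms, symmetric] by simp

text \<open>The remainder \<open>(G h - c) *\<^sub>R h\<close> is of smaller order than
  \<open>h\<close> as soon as \<open>G\<close> has the limit \<open>c\<close>. This differentiates
  the gradient \<open>G (norm x) *\<^sub>R x\<close> at the origin, where no derivative of
  \<open>G\<close> is available.\<close>

lemma has_derivative_scaleR_self_at_0:
  fixes G :: "'a::real_normed_vector \<Rightarrow> real"
  assumes "(G \<longlongrightarrow> c) (at 0)"
  shows "((\<lambda>x. G x *\<^sub>R x) has_derivative (\<lambda>h. c *\<^sub>R h)) (at 0)"
  unfolding has_derivative_at
proof (intro conjI)
  show "bounded_linear (\<lambda>h::'a. c *\<^sub>R h)" by (rule bounded_linear_scaleR_right)
  have "((\<lambda>h. \<bar>G h - c\<bar>) \<longlongrightarrow> 0) (at 0)"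
    using assms by (simp add: LIM_zero_iff tendsto_rabs_zero)
  moreover have "\<forall>\<^sub>F h in at 0. \<bar>G h - c\<bar> = norm (G (0 + h) *\<^sub>R (0 + h) - G 0 *\<^sub>R 0 - c *\<^sub>R h) / norm h"
    by (auto simp: eventually_at_filter scaleR_diff_left [symmetric])
  ultimately show "((\<lambda>h. norm (G (0 + h) *\<^sub>R (0 + h) - G 0 *\<^sub>R 0 - c *\<^sub>R h) / norm h) \<longlongrightarrow> 0) (at 0)"
    by (rule Lim_transform_eventually)
qed

lemma continuous_on_norm_compose:
  fixes g :: "real \<Rightarrow> real"
  assumes "continuous_on {0..} g"
  shows "continuous_on UNIV (\<lambda>x::'a::real_normed_vector. g (norm x))"
  by (rule continuous_on_compose2 [OF assms]) (auto intro: continuous_intros)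

text \<open>Away from the origin this is the chain rule with the derivative \<open>sgn x\<close> of
  the norm, whose factor \<open>1 / norm x\<close> cancels the factor in \<open>s * G s\<close>. At
  the origin the one-sided derivative of \<open>\<phi>\<close> vanishes, so the gradient is
  zero.\<close>

lemma radial_has_derivative:
  fixes \<phi> G :: "real \<Rightarrow> real" and x :: "'a::real_inner"
  assumes G: "continuous_on {0..} G"
    and \<phi>: "\<And>s. s > 0 \<Longrightarrow> (\<phi> has_real_derivative s * G s) (at s)"
    and \<phi>0: "(\<phi> has_real_derivative 0) (at 0 within {0..})"
  shows "((\<lambda>x. \<phi> (norm x)) has_derivative (\<lambda>h. (G (norm x) *\<^sub>R x) \<bullet> h)) (at x)"
proof (cases "x = 0")
  case False
  then have D: "(\<phi> has_derivative (\<lambda>t. t * (norm x * G (norm x)))) (at (norm x))"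
    using \<phi> [of "norm x"] by (auto simp: has_field_derivative_def mult_commute_abs)
  show ?thesis
    by (rule has_derivative_eq_rhs [OF has_derivative_compose [OF has_derivative_norm [OF False] D]])
       (use False in \<open>simp add: fun_eq_iff sgn_div_norm inner_commute\<close>)
next
  case True
  have lim: "((\<lambda>s. (\<phi> s - \<phi> 0) / s) \<longlongrightarrow> 0) (at 0 within {0..})"
    using \<phi>0 by (simp add: has_field_derivative_iff)
  \<comment> \<open>The norm sends punctured neighbourhoods of the origin to one-sided punctured
    neighbourhoods of \<open>0\<close>, so the limit of the one-sided difference quotient carries
    over.\<close>
  have "filterlim (norm :: 'a \<Rightarrow> real) (at 0 within {0..}) (at 0)"
    unfolding filterlim_at by (auto simp: eventually_at_filter intro!: tendsto_norm_zero tendsto_ident_at)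
  from filterlim_compose [OF lim this]
  have "((\<lambda>h::'a. (\<phi> (norm h) - \<phi> 0) / norm h) \<longlongrightarrow> 0) (at 0)" .
  then have "((\<lambda>h::'a. \<bar>(\<phi> (norm h) - \<phi> 0) / norm h\<bar>) \<longlongrightarrow> 0) (at 0)"
    by (rule tendsto_rabs_zero)
  with True show ?thesis
    by (simp add: has_derivative_at)
qed

text \<open>No case distinction is needed at the origin because \<open>sgn 0 = 0\<close>.\<close>

lemma radial_C2:
  fixes \<phi> G H :: "real \<Rightarrow> real"
  assumes G: "continuous_on {0..} G" and H: "continuous_on {0..} H" and H0: "H 0 = 0"
    and \<phi>: "\<And>s. s > 0 \<Longrightarrow> (\<phi> has_real_derivative s * G s) (at s)"
    and \<phi>0: "(\<phi> has_real_derivative 0) (at 0 within {0..})"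
    and DG: "\<And>s. s > 0 \<Longrightarrow> (G has_real_derivative H s / s) (at s)"
  defines "u \<equiv> \<lambda>x::real^'n::finite. \<phi> (norm x)"
  shows "C2 u"
    and "hessian u x = mat (G (norm x)) + (\<chi> i j. H (norm x) * sgn x $ i * sgn x $ j)"
proof -
  let ?M = "\<lambda>x::real^'n. mat (G (norm x)) + (\<chi> i j. H (norm x) * sgn x $ i * sgn x $ j) :: real^'n^'n"
  note d1 = radial_has_derivative [OF G \<phi> \<phi>0]
  have grad: "grad u = (\<lambda>x. G (norm x) *\<^sub>R x)"
    unfolding u_def by (rule ext, rule grad_eqI, rule d1) auto
  have Gc: "continuous_on UNIV (\<lambda>x::real^'n. G (norm x))"
    by (rule continuous_on_norm_compose [OF G])
  have Hc: "continuous_on UNIV (\<lambda>x::real^'n. H (norm x))"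
    by (rule continuous_on_norm_compose [OF H])
  have Mv: "?M x *v h = G (norm x) *\<^sub>R h + (H (norm x) * (sgn x \<bullet> h)) *\<^sub>R sgn x" for x h
  proof -
    have "(mat c *v h) $ i = c * h $ i" for c :: real and h :: "real^'n" and i
      by (simp add: matrix_vector_mult_def mat_def if_distrib [where f = "\<lambda>y. y * _"] cong: if_cong)
    moreover have "((\<chi> i j. H (norm x) * sgn x $ i * sgn x $ j) *v h) $ i
        = H (norm x) * (sgn x \<bullet> h) * sgn x $ i" for i
      by (simp add: matrix_vector_mult_def inner_vec_def sum_distrib_left sum_distrib_right mult_ac)
    ultimately show ?thesis
      by (simp add: vec_eq_iff matrix_vector_mult_add_rdistrib)
  qed
  have d2: "(grad u has_derivative (\<lambda>h. ?M x *v h)) (at x)" for x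
  proof (cases "x = 0")
    case True
    have "((\<lambda>x::real^'n. G (norm x)) \<longlongrightarrow> G 0) (at 0)"
      using Gc by (simp add: continuous_on_def) (metis norm_zero)
    \<comment> \<open>Since \<open>H 0 = 0\<close>, the matrix at the origin acts as multiplication
      by \<open>G 0\<close>, the limit of \<open>G (norm x)\<close>.\<close>
    from has_derivative_scaleR_self_at_0 [OF this] True H0 show ?thesis
      unfolding grad Mv by simp
  next
    case False
    then have "(G has_real_derivative H (norm x) / norm x) (at (norm x))"
      using DG by simp
    then have "(G has_derivative (\<lambda>t. t * (H (norm x) / norm x))) (at (norm x))"
      by (simp only: has_field_derivative_def mult_commute_abs)
    from has_derivative_compose [OF has_derivative_norm [OF False] this]
    have "((\<lambda>x. G (norm x)) has_derivative (\<lambda>h. (sgn x \<bullet> h) * (H (norm x) / norm x))) (at x)"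
      by (simp add: inner_commute)
    from has_derivative_scaleR [OF this has_derivative_ident] False show ?thesis
      unfolding grad Mv by (simp add: sgn_div_norm divide_inverse algebra_simps)
  qed
  show hess: "hessian u x = ?M x" for x
    by (rule hessian_eqI [OF d2])
  \<comment> \<open>Although \<open>sgn\<close> jumps at the origin, its components are at most
    \<open>1\<close> in absolute value, so each entry is squeezed to \<open>0\<close> by
    \<open>H (norm x)\<close>.\<close>
  have "continuous_on UNIV (\<lambda>x::real^'n. H (norm x) * sgn x $ i * sgn x $ j)" for i j
  proof -
    have "isCont (\<lambda>x::real^'n. H (norm x) * sgn x $ i * sgn x $ j) x" for x
    proof (cases "x = 0")
      case False
      have "isCont (\<lambda>x::real^'n. H (norm x)) x"
        using Hc by (simp add: continuous_on_eq_continuous_at)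
      with False show ?thesis
        by (intro continuous_intros) auto
    next
      case True
      have "((\<lambda>x::real^'n. H (norm x)) \<longlongrightarrow> 0) (at 0)"
        using Hc H0 by (simp add: continuous_on_def) (metis norm_zero)
      moreover have "norm (H (norm x) * sgn x $ i * sgn x $ j) \<le> norm (H (norm x))" for x :: "real^'n"
      proof -
        have "\<bar>sgn x $ i\<bar> \<le> 1" for i
          using component_le_norm_cart [of "sgn x" i] norm_sgn [of x] by (auto split: if_splits)
        then have "\<bar>sgn x $ i\<bar> * \<bar>sgn x $ j\<bar> \<le> 1"
          by (simp add: mult_le_one)
        then show ?thesis
          by (simp add: abs_mult mult.assoc mult_left_le)
      qed
      ultimately have "((\<lambda>x::real^'n. H (norm x) * sgn x $ i * sgn x $ j) \<longlongrightarrow> 0) (at 0)"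
        by (rule tendsto_0_le [where K = 1, unfolded mult_1_right, OF _ always_eventually, rule_format])
      with True show ?thesis by (simp add: isCont_def)
    qed
    then show ?thesis by (simp add: continuous_at_imp_continuous_on)
  qed
  moreover have "continuous_on UNIV (\<lambda>x::real^'n. if i = j then G (norm x) else 0)" for i j :: 'n
    using Gc by (cases "i = j") auto
  ultimately have "continuous_on UNIV ?M"
    unfolding mat_def by (intro continuous_on_add continuous_on_vec_lambda) auto
  moreover have "hessian u = ?M"
    by (rule ext) (rule hess)
  ultimately have "continuous_on UNIV (hessian u)" by simp
  moreover have "u differentiable_on UNIV"
    using d1 unfolding u_def by (auto simp: differentiable_on_def differentiable_def)
  moreover have "grad u differentiable_on UNIV"
    using d2 by (auto simp: differentiable_on_def differentiable_def)
  ultimately show "C2 u"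
    by (simp add: C2_def)
qed

subsection \<open>The radial equation\<close>

text \<open>The value at \<open>0\<close> is the limit as \<open>s\<close> tends to
  \<open>0\<close>, because the weight integrates to \<open>s ^ N / N\<close>. The mean is not
  normalised: a constant \<open>b\<close> yields \<open>b / N\<close>.\<close>

definition avg :: "nat \<Rightarrow> (real \<Rightarrow> real) \<Rightarrow> real \<Rightarrow> real" where
  "avg N z s = (if s = 0 then z 0 / real N else integral {0..s} (\<lambda>t. t ^ (N - 1) * z t) / s ^ N)"

lemma integrable_power_mult:
  fixes z :: "real \<Rightarrow> real"
  assumes "continuous_on {0..} z" and "a \<ge> 0"
  shows "(\<lambda>t. t ^ n * z t) integrable_on {a..s}"
  by (intro integrable_continuous_real continuous_intros continuous_on_subset [OF assms(1)])
     (use assms(2) in auto)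

lemma avg_const:
  assumes "N \<ge> 1" and "s \<ge> 0"
  shows "avg N (\<lambda>_. b) s = b / real N"
proof (cases "s = 0")
  case False
  have "((\<lambda>t. t ^ (N - 1) * b) has_integral (s ^ N / N * b - 0 ^ N / N * b)) {0..s}"
    by (rule fundamental_theorem_of_calculus)
       (use assms in \<open>auto intro!: derivative_eq_intros simp: has_real_derivative_iff_has_vector_derivative [symmetric]\<close>)
  then have "integral {0..s} (\<lambda>t. t ^ (N - 1) * b) = s ^ N / N * b"
    using assms by (simp only: integral_unique) simp
  with False show ?thesis by (simp add: avg_def)
qed (simp add: avg_def)

lemma avg_mono:
  assumes "continuous_on {0..} y" and "continuous_on {0..} z" and "s \<ge> 0"
    and "\<And>t. 0 \<le> t \<Longrightarrow> t \<le> s \<Longrightarrow> y t \<le> z t"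
  shows "avg N y s \<le> avg N z s"
  using assms unfolding avg_def
  by (auto intro!: divide_right_mono integral_le integrable_power_mult mult_left_mono)

lemma avg_le:
  assumes "continuous_on {0..} z" and "N \<ge> 1" and "s \<ge> 0"
    and "\<And>t. 0 \<le> t \<Longrightarrow> t \<le> s \<Longrightarrow> z t \<le> b"
  shows "avg N z s \<le> b / real N"
  using avg_mono [of z "\<lambda>_. b" s N] avg_const [of N s b] assms by simp

lemma avg_ge:
  assumes "continuous_on {0..} z" and "N \<ge> 1" and "s \<ge> 0"
    and "\<And>t. 0 \<le> t \<Longrightarrow> t \<le> s \<Longrightarrow> b \<le> z t"
  shows "b / real N \<le> avg N z s"
  using avg_mono [of "\<lambda>_. b" z s N] avg_const [of N s b] assms by simp

lemma avg_pos:
  assumes z: "continuous_on {0..} z" and N: "N \<ge> 1" and s: "s \<ge> 0"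
    and pos: "\<And>t. t \<ge> 0 \<Longrightarrow> z t > 0"
  shows "avg N z s > 0"
proof -
  have "continuous_on {0..s} z"
    by (rule continuous_on_subset [OF z]) auto
  then obtain x where "x \<in> {0..s}" "\<forall>t\<in>{0..s}. z x \<le> z t"
    using continuous_attains_inf [of "{0..s}" z] s by auto
  then have "z x / real N \<le> avg N z s" "z x > 0"
    using pos by (auto intro!: avg_ge [OF z N s])
  moreover have "z x / real N > 0"
    using N \<open>z x > 0\<close> by simp
  ultimately show ?thesis by linarith
qed

lemma integral_power_mult_deriv:
  fixes z :: "real \<Rightarrow> real"
  assumes z: "continuous_on {0..} z" and s: "s > 0"
  shows "((\<lambda>s. integral {0..s} (\<lambda>t. t ^ n * z t)) has_real_derivative s ^ n * z s) (at s)"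
proof -
  have "((\<lambda>s. integral {0..s} (\<lambda>t. t ^ n * z t)) has_real_derivative s ^ n * z s) (at s within {0..s + 1})"
    by (rule integral_has_real_derivative)
       (use s in \<open>auto intro!: continuous_intros continuous_on_subset [OF z]\<close>)
  moreover have "at s within {0..s + 1} = at s"
    by (rule at_within_interior) (use s in auto)
  ultimately show ?thesis by simp
qed

text \<open>With \<open>A = avg N z\<close> this is the first-order equation
  \<open>s A' + N A = z\<close>, obtained from the quotient rule and the fundamental theorem of
  calculus.\<close>

lemma avg_deriv:
  assumes z: "continuous_on {0..} z" and N: "N \<ge> 1" and s: "s > 0"
  shows "(avg N z has_real_derivative (z s - real N * avg N z s) / s) (at s)"
proof -
  let ?B = "\<lambda>s. integral {0..s} (\<lambda>t. t ^ (N - 1) * z t)"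
  have "((\<lambda>s. ?B s / s ^ N) has_real_derivative
      (s ^ (N - 1) * z s * s ^ N - ?B s * (real N * s ^ (N - 1))) / (s ^ N * s ^ N)) (at s)"
    using s by (auto intro!: derivative_eq_intros integral_power_mult_deriv [OF z])
  also have "(s ^ (N - 1) * z s * s ^ N - ?B s * (real N * s ^ (N - 1))) / (s ^ N * s ^ N)
      = (z s - real N * avg N z s) / s"
  proof -
    have "s ^ N = s * s ^ (N - 1)" using N by (simp add: power_eq_if)
    with s show ?thesis by (simp add: avg_def field_simps)
  qed
  finally show ?thesis
    by (rule has_field_derivative_transform_within_open [where S = "{0<..}"]) (use s in \<open>auto simp: avg_def\<close>)
qed

text \<open>For \<open>s > 0\<close> the mean is differentiable. Near \<open>0\<close> the values of
  \<open>z\<close> lie between \<open>z 0 - e\<close> and \<open>z 0 + e\<close>, and monotonicity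
  of the mean carries this squeeze over to \<open>avg N z\<close>.\<close>

lemma avg_continuous_on:
  assumes z: "continuous_on {0..} z" and N: "N \<ge> 1"
  shows "continuous_on {0..} (avg N z)"
  unfolding continuous_on_eq_continuous_within
proof
  fix s :: real assume "s \<in> {0..}"
  then consider "s > 0" | "s = 0" by force
  then show "continuous (at s within {0..}) (avg N z)"
  proof cases
    case 1
    then show ?thesis
      using DERIV_isCont [OF avg_deriv [OF z N]] continuous_at_imp_continuous_at_within by blast
  next
    case 2
    have "\<exists>d>0. \<forall>t\<in>{0..}. dist t 0 < d \<longrightarrow> dist (avg N z t) (avg N z 0) \<le> e" if "e > 0" for e
    proof -
      obtain d where d: "d > 0" "\<And>t. t \<in> {0..} \<Longrightarrow> dist t 0 < d \<Longrightarrow> dist (z t) (z 0) < e"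
        using z \<open>e > 0\<close> unfolding continuous_on_iff by (metis atLeast_iff order_refl)
      have "dist (avg N z t) (avg N z 0) \<le> e" if t: "t \<ge> 0" "t < d" for t
      proof -
        have *: "z 0 - e \<le> z r \<and> z r \<le> z 0 + e" if "0 \<le> r" "r \<le> t" for r
          using d(2) [of r] that t by (simp add: dist_real_def abs_less_iff)
        have "(z 0 - e) / N \<le> avg N z t" "avg N z t \<le> (z 0 + e) / N"
          using * by (auto intro!: avg_ge [OF z N t(1)] avg_le [OF z N t(1)])
        moreover have "e / N \<le> e" using N \<open>e > 0\<close> by (simp add: field_simps)
        ultimately show ?thesis
          by (simp add: avg_def [of N z 0] dist_real_def diff_divide_distrib add_divide_distrib)
      qed
      with d(1) show ?thesis by (auto simp: dist_real_def)
    qed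
    \<comment> \<open>The comparison of means gives only a weak inequality; applying it to a smaller
      positive number makes it strict.\<close>
    then have "\<exists>d>0. \<forall>t\<in>{0..}. dist t 0 < d \<longrightarrow> dist (avg N z t) (avg N z 0) < e" if "e > 0" for e
      using that by (meson dense le_less_trans)
    with 2 show ?thesis
      by (simp add: continuous_within_eps_delta)
  qed
qed

text \<open>Dominated convergence for \<open>s > 0\<close>, and convergence at the single point
  \<open>0\<close> for \<open>s = 0\<close>. The limit \<open>z\<close> is only a pointwise limit
  here.\<close>

lemma avg_tendsto:
  fixes zs :: "nat \<Rightarrow> real \<Rightarrow> real"
  assumes zs: "\<And>m. continuous_on {0..} (zs m)" and s: "s \<ge> 0"
    and bnd: "\<And>m t. 0 \<le> t \<Longrightarrow> t \<le> s \<Longrightarrow> \<bar>zs m t\<bar> \<le> b"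
    and lim: "\<And>t. 0 \<le> t \<Longrightarrow> t \<le> s \<Longrightarrow> (\<lambda>m. zs m t) \<longlonglongrightarrow> z t"
  shows "(\<lambda>m. avg N (zs m) s) \<longlonglongrightarrow> avg N z s"
proof (cases "s = 0")
  case True
  then show ?thesis using lim [of 0] by (simp add: avg_def divide_inverse tendsto_mult_right)
next
  case False
  have "(\<lambda>m. integral {0..s} (\<lambda>t. t ^ (N - 1) * zs m t)) \<longlonglongrightarrow> integral {0..s} (\<lambda>t. t ^ (N - 1) * z t)"
  proof (rule dominated_convergence)
    show "(\<lambda>t. t ^ (N - 1) * zs m t) integrable_on {0..s}" for m
      by (rule integrable_power_mult [OF zs]) auto
    show "(\<lambda>t. t ^ (N - 1) * b) integrable_on {0..s}"
      by (rule integrable_power_mult) auto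
    show "norm (t ^ (N - 1) * zs m t) \<le> t ^ (N - 1) * b" if "t \<in> {0..s}" for m t
      using bnd [of t m] that by (auto simp: abs_mult intro!: mult_left_mono)
    show "(\<lambda>m. t ^ (N - 1) * zs m t) \<longlonglongrightarrow> t ^ (N - 1) * z t" if "t \<in> {0..s}" for t
      using lim that by (simp add: tendsto_mult_left)
  qed
  with False show ?thesis by (simp add: avg_def divide_inverse tendsto_mult_right)
qed

section \<open>Slope and profile of a radial solution\<close>

text \<open>This is \<open>u'(s) / s\<close> for the radial solution \<open>u\<close> with
  right-hand side \<open>z\<close>, read off from the integrated radial equation. Dividing by
  \<open>s\<close> leaves a function that is continuous up to the origin.\<close>

definition slope :: "nat \<Rightarrow> nat \<Rightarrow> (real \<Rightarrow> real) \<Rightarrow> real \<Rightarrow> real" where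
  "slope N k z s = root k (real k / real ((N - 1) choose (k - 1)) * avg N z s)"

definition profile :: "nat \<Rightarrow> nat \<Rightarrow> real \<Rightarrow> (real \<Rightarrow> real) \<Rightarrow> real \<Rightarrow> real" where
  "profile N k a z r = a + integral {0..r} (\<lambda>s. s * slope N k z s)"

lemma slope_continuous_on:
  assumes "continuous_on {0..} z" and "N \<ge> 1"
  shows "continuous_on {0..} (slope N k z)"
  unfolding slope_def by (intro continuous_intros avg_continuous_on assms)

lemma slope_mono:
  assumes "k \<ge> 1" and "continuous_on {0..} y" and "continuous_on {0..} z" and "s \<ge> 0"
    and "\<And>t. 0 \<le> t \<Longrightarrow> t \<le> s \<Longrightarrow> y t \<le> z t"
  shows "slope N k y s \<le> slope N k z s"
  unfolding slope_def
  by (intro real_root_le_mono mult_left_mono avg_mono assms) (use assms in auto)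

lemma slope_nonneg:
  assumes "k \<ge> 1" and "N \<ge> 1" and "continuous_on {0..} z" and "s \<ge> 0"
    and "\<And>t. 0 \<le> t \<Longrightarrow> t \<le> s \<Longrightarrow> 0 \<le> z t"
  shows "0 \<le> slope N k z s"
  using avg_ge [of z N s 0] assms unfolding slope_def by (simp add: real_root_ge_zero)

lemma profile_deriv_within:
  assumes z: "continuous_on {0..} z" and N: "N \<ge> 1" and s: "s \<ge> 0"
  shows "(profile N k a z has_real_derivative s * slope N k z s) (at s within {0..})"
proof -
  have "((\<lambda>r. integral {0..r} (\<lambda>s. s * slope N k z s)) has_real_derivative s * slope N k z s) (at s within {0..s + 1})"
    by (rule integral_has_real_derivative)
       (use s in \<open>auto intro!: continuous_intros continuous_on_subset [OF slope_continuous_on [OF z N]]\<close>)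
  then have "(profile N k a z has_real_derivative s * slope N k z s) (at s within {0..s + 1})"
    unfolding profile_def by (auto intro!: derivative_eq_intros)
  moreover have "at s within {0..s + 1} = at s within {0..}"
    by (rule at_within_nhd [where S = "{..<s + 1}"]) auto
  ultimately show ?thesis by simp
qed

lemma profile_deriv:
  assumes "continuous_on {0..} z" and "N \<ge> 1" and "s > 0"
  shows "(profile N k a z has_real_derivative s * slope N k z s) (at s)"
proof -
  have "at s within {0..} = at s"
    by (rule at_within_interior) (use assms in auto)
  then show ?thesis
    using profile_deriv_within [of z N s k a] assms by simp
qed

lemma profile_0 [simp]: "profile N k a z 0 = a"
  by (simp add: profile_def)

lemma profile_continuous_on:
  assumes "continuous_on {0..} z" and "N \<ge> 1"
  shows "continuous_on {0..} (profile N k a z)"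
  by (rule DERIV_continuous_on, rule profile_deriv_within [OF assms]) auto

lemma slope_mult_integrable:
  assumes "continuous_on {0..} z" and "N \<ge> 1"
  shows "(\<lambda>s. s * slope N k z s) integrable_on {0..r}"
  by (intro integrable_continuous_real continuous_intros
      continuous_on_subset [OF slope_continuous_on [OF assms]]) auto

lemma profile_mono:
  assumes "k \<ge> 1" and "N \<ge> 1" and "continuous_on {0..} y" and "continuous_on {0..} z" and "r \<ge> 0"
    and "\<And>t. 0 \<le> t \<Longrightarrow> t \<le> r \<Longrightarrow> y t \<le> z t"
  shows "profile N k a y r \<le> profile N k a z r"
proof -
  have "integral {0..r} (\<lambda>s. s * slope N k y s) \<le> integral {0..r} (\<lambda>s. s * slope N k z s)"
  proof (rule integral_le)
    show "s * slope N k y s \<le> s * slope N k z s" if "s \<in> {0..r}" for s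
      using that assms(6) by (intro mult_left_mono slope_mono assms(1,3,4)) auto
  qed (intro slope_mult_integrable assms)+
  then show ?thesis by (simp add: profile_def)
qed

lemma profile_ge:
  assumes "k \<ge> 1" and "N \<ge> 1" and "continuous_on {0..} z" and "r \<ge> 0"
    and "\<And>t. 0 \<le> t \<Longrightarrow> t \<le> r \<Longrightarrow> 0 \<le> z t"
  shows "a \<le> profile N k a z r"
proof -
  have "0 \<le> integral {0..r} (\<lambda>s. s * slope N k z s)"
  proof (rule integral_nonneg)
    show "0 \<le> s * slope N k z s" if "s \<in> {0..r}" for s
      using that assms(5) by (intro mult_nonneg_nonneg slope_nonneg assms(1,2,3)) auto
  qed (intro slope_mult_integrable assms)
  then show ?thesis by (simp add: profile_def)
qed

text \<open>Logarithmic differentiation of \<open>G ^ k = c A\<close> gives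
  \<open>G' = G / (k A) * A'\<close>, with \<open>A'\<close> taken from the equation for the mean.
  Positivity of \<open>z\<close> keeps \<open>A\<close> away from \<open>0\<close>, where the root
  is not differentiable.\<close>

lemma slope_deriv:
  assumes z: "continuous_on {0..} z" and pos: "\<And>t. t \<ge> 0 \<Longrightarrow> z t > 0"
    and k: "1 \<le> k" "k \<le> N" and s: "s > 0"
  shows "(slope N k z has_real_derivative
     slope N k z s / (real k * avg N z s) * (z s - real N * avg N z s) / s) (at s)"
proof -
  define c where "c = real k / real ((N - 1) choose (k - 1))"
  have N: "N \<ge> 1" using k by simp
  have A: "avg N z s > 0" using avg_pos [OF z N _ pos] s by simp
  have c: "c > 0" unfolding c_def using k by (simp add: zero_less_binomial)
  have k0: "k > 0" using k by simp
  have slope: "slope N k z = (\<lambda>s. root k (c * avg N z s))"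
    by (simp add: slope_def c_def fun_eq_iff)
  define G where "G = slope N k z s"
  define D where "D = (z s - real N * avg N z s) / s"
  have Gk: "G ^ k = c * avg N z s" "G > 0"
    using mult_pos_pos [OF c A] k0 by (auto simp: G_def slope real_root_pow_pos)
  have "(slope N k z has_real_derivative inverse (real k * G ^ (k - Suc 0)) * (c * D)) (at s)"
    unfolding slope D_def G_def
    by (rule DERIV_chain2 [OF DERIV_real_root [OF k0] DERIV_cmult [OF avg_deriv [OF z N s]]])
       (rule mult_pos_pos [OF c A])
  moreover have "inverse (real k * G ^ (k - Suc 0)) * c = G / (real k * avg N z s)"
  proof -
    have "c * (real k * avg N z s) = G * (real k * G ^ (k - Suc 0))"
      using Gk(1) k0 by (simp add: power_eq_if mult_ac)
    then have "c / (real k * G ^ (k - Suc 0)) = G / (real k * avg N z s)"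
      using k0 A Gk(2) by (subst frac_eq_eq) auto
    then show ?thesis by (simp add: divide_inverse mult.commute)
  qed
  ultimately have "(slope N k z has_real_derivative G / (real k * avg N z s) * D) (at s)"
    by (metis mult.assoc)
  then show ?thesis by (simp add: G_def D_def)
qed

text \<open>The Hessian is \<open>G I + H e e^T\<close> with \<open>H = s G'\<close>, so the
  \<open>j\<close>-th elementary symmetric value is a binomial coefficient times
  \<open>G ^ j * (N / j - N / k + z / (k A))\<close>. For \<open>j \<le> k\<close> the bracket is
  positive, which gives admissibility; for \<open>j = k\<close> it equals \<open>z / (k A)\<close>,
  and \<open>G ^ k = c A\<close> turns the value into \<open>z\<close>.\<close>

lemma radial_solution:
  fixes z :: "real \<Rightarrow> real" and a :: real
  assumes z: "continuous_on {0..} z" and pos: "\<And>t. t \<ge> 0 \<Longrightarrow> z t > 0"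
    and k: "1 \<le> k" "k \<le> CARD('n::finite)"
  defines "u \<equiv> \<lambda>x::real^'n. profile CARD('n) k a z (norm x)"
  shows "u \<in> admissible k"
    and "elem_sym k (eigenvalues (hessian u x)) = z (norm x)"
proof -
  define N where "N = CARD('n)"
  have N: "N \<ge> 1" and kN: "k \<le> N" using k by (auto simp: N_def)
  define G where "G = slope N k z"
  define A where "A = avg N z"
  \<comment> \<open>This is \<open>s * G' s\<close>, written so that it also makes sense at
    \<open>0\<close>, where it vanishes because the mean there is \<open>z 0 / N\<close>.\<close>
  define H where "H s = G s / (real k * A s) * (z s - real N * A s)" for s
  have A: "A s > 0" if "s \<ge> 0" for s
    unfolding A_def by (rule avg_pos [OF z N that pos])
  have Ac: "continuous_on {0..} A"
    unfolding A_def by (rule avg_continuous_on [OF z N])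
  have Gc: "continuous_on {0..} G"
    unfolding G_def by (rule slope_continuous_on [OF z N])
  have Hc: "continuous_on {0..} H"
    unfolding H_def using A k by (intro continuous_intros Ac Gc z) (use A in \<open>force simp: less_le\<close>)
  have H0: "H 0 = 0"
    using N by (simp add: H_def A_def avg_def)
  have deriv0: "(profile N k a z has_real_derivative 0) (at 0 within {0..})"
    using profile_deriv_within [OF z N, of 0] by simp
  note C2 = radial_C2 [OF Gc Hc H0, of "profile N k a z", OF _ deriv0]
  have DG: "(G has_real_derivative H s / s) (at s)" if "s > 0" for s
    using slope_deriv [OF z pos k(1) kN that] by (simp add: G_def H_def A_def)
  have "C2 u"
    unfolding u_def N_def [symmetric]
    by (rule C2(1)) (auto simp: G_def intro!: profile_deriv [OF z N] DG [unfolded G_def])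
  have hess: "hessian u x = mat (G (norm x)) + (\<chi> i j. H (norm x) * sgn x $ i * sgn x $ j)" for x
    unfolding u_def N_def [symmetric]
    by (rule C2(2)) (auto simp: G_def intro!: profile_deriv [OF z N] DG [unfolded G_def])
  have Gk: "G s ^ k = real k / real ((N - 1) choose (k - 1)) * A s" "G s > 0" if "s \<ge> 0" for s
  proof -
    have "real k / real ((N - 1) choose (k - 1)) * A s > 0"
      using k kN A [OF that] by (intro mult_pos_pos divide_pos_pos) (auto simp: zero_less_binomial)
    then show "G s ^ k = real k / real ((N - 1) choose (k - 1)) * A s" "G s > 0"
      using k by (auto simp: G_def A_def slope_def real_root_pow_pos simp del: times_divide_eq_left)
  qed
  have ev: "elem_sym j (eigenvalues (hessian u x))
      = real ((N - 1) choose (j - 1)) * G (norm x) ^ j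
        * (real N / real j - real N / real k + z (norm x) / (real k * A (norm x)))"
    if j: "1 \<le> j" "j \<le> k" for j x
  proof -
    \<comment> \<open>The rank-one formula needs a unit vector. At the origin \<open>sgn x\<close>
      is zero, but so is \<open>H 0\<close>, and any coordinate axis serves.\<close>
    obtain e :: "real^'n" where e: "norm e = 1"
      "(\<chi> i j. H (norm x) * sgn x $ i * sgn x $ j) = (\<chi> i j. H (norm x) * e $ i * e $ j)"
    proof (cases "x = 0")
      case True
      then show ?thesis by (intro that [of "axis undefined 1"]) (auto simp: H0)
    next
      case False
      then show ?thesis by (intro that [of "sgn x"]) (auto simp: norm_sgn)
    qed
    let ?G = "G (norm x)" and ?A = "A (norm x)" and ?b = "real ((N - 1) choose (j - 1))"
    have expand: "elem_sym j (eigenvalues (hessian u x))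
        = real ((N - 1) choose j) * ?G ^ j + ?b * ?G ^ (j - 1) * (?G + H (norm x))"
      unfolding hess e(2) N_def by (rule elem_sym_eigenvalues_rank_one_update [OF e(1) j(1)])
    \<comment> \<open>The absorption identities for binomial coefficients express both terms of
      \<open>expand\<close> through the one coefficient \<open>?b\<close>.\<close>
    have "real j * real ((N - 1) choose j) = (real N - real j) * ?b"
    proof -
      have "j * ((N - 1) choose j) = (N - j) * ((N - 1) choose (j - 1))"
        using binomial_absorb_comp [of "N - 1" "j - 1"] binomial_absorption [of "j - 1" "N - 1"] j kN
        by simp
      then have "real (j * ((N - 1) choose j)) = real ((N - j) * ((N - 1) choose (j - 1)))"
        by simp
      then show ?thesis using j kN by (simp add: of_nat_diff)
    qed
    then have binom: "real ((N - 1) choose j) = (real N / real j - 1) * ?b"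
      using j by (simp add: field_simps)
    have GH: "?G + H (norm x) = ?G * (1 + (z (norm x) / (real k * ?A) - real N / real k))"
      using A [of "norm x"] k by (simp add: H_def field_simps)
    have "(real N / real j - 1) * ?b * ?G ^ j
        + ?b * ?G ^ (j - 1) * (?G * (1 + (z (norm x) / (real k * ?A) - real N / real k)))
        = ?b * ?G ^ j * (real N / real j - real N / real k + z (norm x) / (real k * ?A))"
    proof -
      have "?G ^ j = ?G * ?G ^ (j - 1)" using j by (simp add: power_eq_if)
      then show ?thesis by (simp only: algebra_simps)
    qed
    then show ?thesis by (simp only: expand binom GH)
  qed
  have b: "real ((N - 1) choose (j - 1)) > 0" if "1 \<le> j" "j \<le> k" for j
    using that kN by (simp add: zero_less_binomial)
  show "elem_sym k (eigenvalues (hessian u x)) = z (norm x)"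
  proof -
    have "elem_sym k (eigenvalues (hessian u x))
        = real ((N - 1) choose (k - 1)) * (real k / real ((N - 1) choose (k - 1)) * A (norm x))
          * (z (norm x) / (real k * A (norm x)))"
      using ev [OF k(1) order_refl, of x] Gk(1) [of "norm x"] by simp
    also have "\<dots> = z (norm x)"
      using b [OF k(1) order_refl] A [of "norm x"] k by (simp add: field_simps)
    finally show ?thesis .
  qed
  have "elem_sym j (eigenvalues (hessian u x)) > 0" if j: "1 \<le> j" "j \<le> k" for j x
  proof -
    have "real N / real k \<le> real N / real j"
      using j by (intro divide_left_mono) auto
    moreover have "z (norm x) / (real k * A (norm x)) > 0"
      using pos [of "norm x"] A [of "norm x"] k by simp
    ultimately have "real N / real j - real N / real k + z (norm x) / (real k * A (norm x)) > 0"
      by linarith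
    then show ?thesis
      unfolding ev [OF j] using b [OF j] Gk(2) [of "norm x"] by simp
  qed
  with \<open>C2 u\<close> show "u \<in> admissible k"
    by (simp add: admissible_def garding_cone_def)
qed

subsection \<open>The integral conditions on the data\<close>

text \<open>By contraposition: if all integrals over \<open>{a..M}\<close> were at most
  \<open>B\<close>, they would increase to a finite limit, which would be the value of the improper
  integral. This turns the Keller-Osserman divergence into a concrete endpoint
  \<open>M\<close>.\<close>

lemma nn_integral_infinite_imp_integral_unbounded:
  fixes \<phi> :: "real \<Rightarrow> real"
  assumes cont: "continuous_on {a..} \<phi>" and nonneg: "\<And>t. t \<ge> a \<Longrightarrow> \<phi> t \<ge> 0"
    and inf: "(\<integral>\<^sup>+t\<in>{a..}. ennreal (\<phi> t) \<partial>lborel) = \<infinity>"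
  obtains M where "M \<ge> a" and "B < integral {a..M} \<phi>"
proof (rule ccontr)
  assume no: "\<not> thesis"
  note witness = that
  have bound: "integral {a..M} \<phi> \<le> B" if "M \<ge> a" for M
    using witness [OF that] no by force
  have int: "\<phi> integrable_on {a..y}" for y
    by (intro integrable_continuous_real continuous_on_subset [OF cont]) auto
  have mono: "mono (\<lambda>y. integral {a..y} \<phi>)"
  proof (rule monoI)
    fix x y :: real assume "x \<le> y"
    then show "integral {a..x} \<phi> \<le> integral {a..y} \<phi>"
      by (intro integral_subset_le int) (use nonneg in auto)
  qed
  have "incseq (\<lambda>n. integral {a..real n} \<phi>)"
    using mono by (auto simp: mono_def)
  \<comment> \<open>The maximum with \<open>0\<close> covers those \<open>n\<close> below
    \<open>a\<close>, for which the interval is empty.\<close>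
  moreover have "integral {a..real n} \<phi> \<le> max B 0" for n
    using bound [of "real n"] by (cases "a \<le> real n") auto
  ultimately obtain l where "(\<lambda>n. integral {a..real n} \<phi>) \<longlonglongrightarrow> l"
    using incseq_convergent by blast
  then have "((\<lambda>y. integral {a..y} \<phi>) \<longlongrightarrow> l) at_top"
    by (rule tendsto_at_topI_sequentially_real [OF mono])
  then have "(\<phi> has_integral l) {a..}"
    by (intro has_integral_to_inf int nonneg)
  then have "(\<integral>\<^sup>+t\<in>{a..}. ennreal (\<phi> t) \<partial>lborel) = ennreal l"
    by (intro nn_integral_has_integral_lebesgue' nonneg) auto
  with inf show False by simp
qed

lemma integral_le_nn_integral:
  fixes J :: "real \<Rightarrow> real"
  assumes "continuous_on {a..b} J" and "\<And>t. t \<in> S \<Longrightarrow> J t \<ge> 0" and "{a..b} \<subseteq> S"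
    and fin: "(\<integral>\<^sup>+t\<in>S. ennreal (J t) \<partial>lborel) < \<infinity>"
  shows "integral {a..b} J \<le> enn2real (\<integral>\<^sup>+t\<in>S. ennreal (J t) \<partial>lborel)"
proof -
  have "(J has_integral integral {a..b} J) {a..b}"
    by (intro integrable_integral integrable_continuous_real assms)
  then have "ennreal (integral {a..b} J) = (\<integral>\<^sup>+t\<in>{a..b}. ennreal (J t) \<partial>lborel)"
    by (intro nn_integral_has_integral_lebesgue' [symmetric]) (use assms in auto)
  also have "\<dots> \<le> (\<integral>\<^sup>+t\<in>S. ennreal (J t) \<partial>lborel)"
    using assms(3) by (intro nn_integral_mono) (auto simp: indicator_def)
  finally show ?thesis
    using fin by (metis enn2real_mono enn2real_ennreal infinity_ennreal_def integral_nonneg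
        assms(1,2,3) integrable_continuous_real subsetD)
qed

text \<open>With \<open>h\<close> the root in the conclusion, the integrand of the hypothesis is
  \<open>t powr (1 + \<epsilon>) * h t ^ 2\<close>. On \<open>[1, \<infinity>)\<close> the function
  \<open>h\<close> is bounded by this integrand plus \<open>t powr (-1 - \<epsilon>)\<close>, and
  both have finite integrals.\<close>

lemma weight_integral_bounded:
  fixes P :: "real \<Rightarrow> real"
  assumes P: "continuous_on {0..} P" and pos: "\<And>t. t \<ge> 0 \<Longrightarrow> P t > 0" and k: "k \<ge> 1" and \<epsilon>: "\<epsilon> > 0"
    and fin: "(\<integral>\<^sup>+t\<in>{0..}. ennreal (t powr (1 + \<epsilon> + 2 * (real k - 1) / (real k + 1)) *
             P t powr (2 / (real k + 1))) \<partial>lborel) < \<infinity>"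
  obtains L where "\<And>r. r \<ge> 0 \<Longrightarrow> integral {0..r} (\<lambda>t. root (k + 1) (t ^ (k - 1) * P t)) \<le> L"
proof -
  define h where "h t = root (k + 1) (t ^ (k - 1) * P t)" for t
  define J where "J t = t powr (1 + \<epsilon> + 2 * (real k - 1) / (real k + 1)) * P t powr (2 / (real k + 1))" for t
  define T where "T = enn2real (\<integral>\<^sup>+t\<in>{0..}. ennreal (J t) \<partial>lborel)"
  have hc: "continuous_on {0..} h"
    unfolding h_def by (intro continuous_intros P)
  have hi: "h integrable_on {a..b}" if "a \<ge> 0" for a b
    by (intro integrable_continuous_real continuous_on_subset [OF hc]) (use that in auto)
  have hn: "h t \<ge> 0" if "t \<ge> 0" for t
    using that pos [OF that] by (simp add: h_def)
  have Jc: "continuous_on {1..r} J" for r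
    unfolding J_def using pos
    by (intro continuous_intros continuous_on_subset [OF P]) (force simp: less_le)+
  have hJ: "h t \<le> t powr (-1 - \<epsilon>) + J t" if "t \<ge> 1" for t
  proof -
    have t: "t > 0" and Pt: "P t > 0" using that pos [of t] by auto
    have h: "h t = (t ^ (k - 1) * P t) powr (1 / (real k + 1))"
      unfolding h_def using t Pt by (subst root_powr_inverse) (auto simp: divide_inverse add.commute)
    have "h t ^ 2 = (t ^ (k - 1) * P t) powr (2 / (real k + 1))"
      unfolding h using t Pt by (simp add: power2_eq_square powr_add [symmetric])
    also have "\<dots> = (t powr real (k - 1)) powr (2 / (real k + 1)) * P t powr (2 / (real k + 1))"
      using t Pt by (simp add: powr_mult powr_realpow)
    also have "(t powr real (k - 1)) powr (2 / (real k + 1)) = t powr (2 * (real k - 1) / (real k + 1))"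
      using k by (simp add: powr_powr of_nat_diff mult_ac)
    finally have J: "J t = t powr (1 + \<epsilon>) * h t ^ 2"
      by (simp add: J_def powr_add)
    have inv: "t powr (-1 - \<epsilon>) * t powr (1 + \<epsilon>) = 1"
      using t by (simp add: powr_add [symmetric])
    show ?thesis
    \<comment> \<open>\<open>h \<le> max (1/\<tau>) (\<tau> h\<^sup>2)\<close> for every \<open>\<tau> > 0\<close>, here with \<open>\<tau> = t powr (1 + \<epsilon>)\<close>\<close>
    proof (cases "h t \<le> t powr (-1 - \<epsilon>)")
      case True
      moreover have "J t \<ge> 0" by (simp add: J)
      ultimately show ?thesis by linarith
    next
      case False
      then have "t powr (-1 - \<epsilon>) * t powr (1 + \<epsilon>) \<le> h t * t powr (1 + \<epsilon>)"
        by (intro mult_right_mono) auto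
      then have "1 * h t \<le> (h t * t powr (1 + \<epsilon>)) * h t"
        unfolding inv using hn [of t] t by (intro mult_right_mono) auto
      then have "h t \<le> J t" by (simp add: J power2_eq_square mult_ac)
      then show ?thesis using powr_ge_zero [of t "-1 - \<epsilon>"] by linarith
    qed
  qed
  \<comment> \<open>The three terms bound the part on \<open>[0, 1]\<close>, the integral of
    \<open>t powr (-1 - \<epsilon>)\<close> over \<open>[1, \<infinity>)\<close>, and the
    contribution of \<open>J\<close>.\<close>
  have "integral {0..r} h \<le> integral {0..1} h + 1 / \<epsilon> + T" if r: "r \<ge> 0" for r
  proof -
    have "integral {0..r} h \<le> integral {0..max 1 r} h"
      by (intro integral_subset_le hi) (use hn r in auto)
    also have "\<dots> = integral {0..1} h + integral {1..max 1 r} h"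
      by (rule Henstock_Kurzweil_Integration.integral_combine [symmetric]) (use hi in auto)
    also have "integral {1..max 1 r} h \<le> integral {1..max 1 r} (\<lambda>t. t powr (-1 - \<epsilon>) + J t)"
      by (intro integral_le hi integrable_continuous_real continuous_intros Jc) (use hJ in auto)
    also have "\<dots> = integral {1..max 1 r} (\<lambda>t. t powr (-1 - \<epsilon>)) + integral {1..max 1 r} J"
      by (intro integral_add integrable_continuous_real continuous_intros Jc) auto
    also have "integral {1..max 1 r} J \<le> T"
      unfolding T_def by (rule integral_le_nn_integral [OF Jc]) (use fin in \<open>auto simp: J_def\<close>)
    also have "integral {1..max 1 r} (\<lambda>t. t powr (-1 - \<epsilon>)) \<le> 1 / \<epsilon>"
    proof (rule has_integral_subset_le)
      show "((\<lambda>t::real. t powr (-1 - \<epsilon>)) has_integral 1 / \<epsilon>) {1..}"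
        using has_integral_powr_to_inf [of "-1 - \<epsilon>" 1] \<epsilon> by simp
      show "((\<lambda>t::real. t powr (-1 - \<epsilon>)) has_integral integral {1..max 1 r} (\<lambda>t. t powr (-1 - \<epsilon>))) {1..max 1 r}"
        by (intro integrable_integral integrable_continuous_real continuous_intros) auto
    qed auto
    finally show ?thesis by simp
  qed
  then show ?thesis
    using that unfolding h_def by blast
qed

text \<open>On the compact interval \<open>[0, R]\<close> the ratio of the maximum of
  \<open>P\<close> to its minimum is the price of comparing two points; beyond \<open>R\<close>
  monotonicity costs nothing. A pair on both sides of \<open>R\<close> is compared through
  \<open>R\<close> itself.\<close>

lemma eventually_mono_imp_quasi_mono:
  fixes P :: "real \<Rightarrow> real"
  assumes P: "continuous_on {0..} P" and pos: "\<And>t. t \<ge> 0 \<Longrightarrow> P t > 0"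
    and \<alpha>: "\<alpha> \<ge> 0" and R: "R > 0" and mono: "mono_on {R..} (\<lambda>r. r powr \<alpha> * P r)"
  obtains K where "K > 0"
    and "\<And>s r. 0 < s \<Longrightarrow> s \<le> r \<Longrightarrow> s powr \<alpha> * P s \<le> K * (r powr \<alpha> * P r)"
proof -
  have PR: "continuous_on {0..R} P" by (rule continuous_on_subset [OF P]) auto
  obtain a where a: "a \<in> {0..R}" "\<And>t. t \<in> {0..R} \<Longrightarrow> P a \<le> P t"
    using continuous_attains_inf [of "{0..R}" P] PR R by auto
  obtain b where b: "b \<in> {0..R}" "\<And>t. t \<in> {0..R} \<Longrightarrow> P t \<le> P b"
    using continuous_attains_sup [of "{0..R}" P] PR R by auto
  define K where "K = P b / P a"
  have Pa: "P a > 0" using pos a by auto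
  have K: "K \<ge> 1" using a(2) [OF b(1)] Pa by (simp add: K_def)
  have low: "s powr \<alpha> * P s \<le> K * (r powr \<alpha> * P r)" if "0 < s" "s \<le> r" "r \<le> R" for s r
  proof -
    have "P s \<le> K * P a" using b(2) [of s] that Pa by (simp add: K_def)
    also have "\<dots> \<le> K * P r" using a(2) [of r] that K by (intro mult_left_mono) auto
    finally have "s powr \<alpha> * P s \<le> r powr \<alpha> * (K * P r)"
      using that \<alpha> pos [of s] by (intro mult_mono powr_mono2) auto
    then show ?thesis by (simp add: mult_ac)
  qed
  have nn: "r powr \<alpha> * P r \<ge> 0" if "r > 0" for r
    using pos [of r] that by simp
  show ?thesis
  proof (rule that)
    show "K > 0" using K by simp
    fix s r :: real assume sr: "0 < s" "s \<le> r"
    have mono': "x powr \<alpha> * P x \<le> y powr \<alpha> * P y" if "R \<le> x" "x \<le> y" for x y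
      using mono_onD [OF mono, of x y] that by simp
    consider "r \<le> R" | "s \<le> R" "R \<le> r" | "R \<le> s" by linarith
    then show "s powr \<alpha> * P s \<le> K * (r powr \<alpha> * P r)"
    proof cases
      case 1 then show ?thesis using low sr by simp
    next
      case 2
      have "s powr \<alpha> * P s \<le> K * (R powr \<alpha> * P R)" using low sr 2 R by simp
      also have "\<dots> \<le> K * (r powr \<alpha> * P r)" using mono' 2 K by (intro mult_left_mono) auto
      finally show ?thesis .
    next
      case 3
      have "s powr \<alpha> * P s \<le> 1 * (r powr \<alpha> * P r)" using mono' 3 sr by simp
      also have "\<dots> \<le> K * (r powr \<alpha> * P r)" using nn K sr by (intro mult_right_mono) auto
      finally show ?thesis .
    qed
  qed
qed

subsection \<open>The energy estimate\<close>

text \<open>For \<open>Y = s powr (N / k) * G\<close> the radial equation says that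
  \<open>Y ^ k\<close> has derivative \<open>c * s ^ (N - 1) * z\<close>. Hence
  \<open>Y ^ (k + 1)\<close> has derivative \<open>(k + 1) / k * Y\<close> times this, and the last
  factor \<open>s * G\<close> in the result is \<open>u'\<close>.\<close>

lemma slope_energy_deriv:
  assumes z: "continuous_on {0..} z" and pos: "\<And>t. t \<ge> 0 \<Longrightarrow> z t > 0"
    and k: "1 \<le> k" "k \<le> N" and s: "s > 0"
  shows "((\<lambda>s. (s powr (real N / real k) * slope N k z s) ^ (k + 1)) has_real_derivative
     (real k + 1) / real ((N - 1) choose (k - 1)) * (s powr (real N + real N / real k - 2) * z s)
       * (s * slope N k z s)) (at s)"
proof -
  have N: "N \<ge> 1" and k0: "k > 0" using k by auto
  define G where "G = slope N k z s"
  define A where "A = avg N z s"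
  define x where "x = s powr (real N / real k)"
  define b where "b = real ((N - 1) choose (k - 1))"
  have b: "b > 0" unfolding b_def using k by (simp add: zero_less_binomial)
  have A: "A > 0" unfolding A_def using avg_pos [OF z N _ pos] s by simp
  have "real k / b * A > 0" using A b k0 by simp
  then have Gk: "G ^ k = real k / b * A"
    using k0 unfolding G_def slope_def b_def [symmetric] A_def [symmetric] by (simp add: real_root_pow_pos)
  have xk: "x ^ k = s ^ N"
    unfolding x_def using s k0 by (simp add: powr_realpow [symmetric] powr_powr)
  have x': "s powr (real N / real k - 1) = x / s"
    using s by (simp add: x_def powr_diff)
  have w: "s powr (real N + real N / real k - 2) = s ^ N * x / s\<^sup>2"
    using s by (simp add: x_def powr_diff powr_add powr_realpow)
  have "((\<lambda>s. s powr (real N / real k) * slope N k z s) has_real_derivative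
      (real N / real k * s powr (real N / real k - 1)) * G
        + G / (real k * A) * (z s - real N * A) / s * x) (at s)"
    unfolding G_def A_def x_def
    by (rule DERIV_mult [OF has_real_derivative_powr [OF s] slope_deriv [OF z pos k s]])
  \<comment> \<open>The exponent \<open>N / k\<close> is chosen so that the term from
    differentiating the power cancels the \<open>- N A\<close> term of the slope derivative.\<close>
  also have "(real N / real k * s powr (real N / real k - 1)) * G
        + G / (real k * A) * (z s - real N * A) / s * x = x * G * z s / (real k * A * s)"
    unfolding x' using A k0 s by (simp add: field_simps)
  finally have "((\<lambda>s. s powr (real N / real k) * slope N k z s) has_real_derivative
      x * G * z s / (real k * A * s)) (at s)" .
  from DERIV_power [OF this, of "k + 1"]
  have "((\<lambda>s. (s powr (real N / real k) * slope N k z s) ^ (k + 1)) has_real_derivative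
      real (k + 1) * (x * G * z s / (real k * A * s) * (x * G) ^ k)) (at s)"
    by (simp only: G_def x_def One_nat_def add_diff_cancel_right')
  also have "real (k + 1) * (x * G * z s / (real k * A * s) * (x * G) ^ k)
     = (real k + 1) / b * (s powr (real N + real N / real k - 2) * z s) * (s * G)"
    unfolding power_mult_distrib xk Gk w using A b k0 s by (simp add: field_simps power2_eq_square)
  finally show ?thesis by (simp add: G_def b_def)
qed

text \<open>With \<open>w\<close> the sum of the two profiles, both right-hand sides are at most
  \<open>P * \<Phi> w\<close>, and the weight times \<open>P\<close> is at most \<open>B\<close>. So
  the derivatives of the two energies add up to at most \<open>c * B * \<Phi> w * w'\<close>, the
  derivative of \<open>c * B * F w\<close>; integration from \<open>0\<close> gives the
  claim.\<close>

lemma slope_energy_bound: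
  fixes y z :: "real \<Rightarrow> real"
  assumes k: "1 \<le> k" "k \<le> N"
    and y: "continuous_on {0..} y" and ypos: "\<And>t. t \<ge> 0 \<Longrightarrow> y t > 0"
    and z: "continuous_on {0..} z" and zpos: "\<And>t. t \<ge> 0 \<Longrightarrow> z t > 0"
    and F: "\<And>t. t > 0 \<Longrightarrow> (F has_real_derivative \<Phi> t) (at t)"
    and F0: "F (a + b) \<ge> 0" and ab: "a + b > 0"
    and yP: "\<And>t. t > 0 \<Longrightarrow> y t \<le> P t * \<Phi> (profile N k a y t + profile N k b z t)"
    and zP: "\<And>t. t > 0 \<Longrightarrow> z t \<le> P t * \<Phi> (profile N k a y t + profile N k b z t)"
    and \<Phi>: "\<And>t. t > 0 \<Longrightarrow> \<Phi> t \<ge> 0"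
    and W: "\<And>t. 0 < t \<Longrightarrow> t \<le> R \<Longrightarrow> t powr (real N + real N / real k - 2) * P t \<le> B" and R: "R > 0"
  shows "(R powr (real N / real k) * slope N k y R) ^ (k + 1)
       + (R powr (real N / real k) * slope N k z R) ^ (k + 1)
     \<le> (real k + 1) / real ((N - 1) choose (k - 1)) * B * F (profile N k a y R + profile N k b z R)"
proof -
  define w where "w t = profile N k a y t + profile N k b z t" for t
  define E where "E x t = (t powr (real N / real k) * slope N k x t) ^ (k + 1)" for x t
  define c where "c = (real k + 1) / real ((N - 1) choose (k - 1))"
  have N: "N \<ge> 1" using k by simp
  have c: "c \<ge> 0" by (simp add: c_def)
  have wpos: "w t > 0" if "t \<ge> 0" for t
    using profile_ge [OF k(1) N y that less_imp_le [OF ypos], of a]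
      profile_ge [OF k(1) N z that less_imp_le [OF zpos], of b] ab by (simp add: w_def)
  have wc: "continuous_on {0..} w"
    unfolding w_def by (intro continuous_intros profile_continuous_on y z N)
  have Fc: "continuous_on {0<..} F"
    by (rule DERIV_continuous_on, rule has_field_derivative_at_within, rule F) auto
  have Ec: "continuous_on {0..} (E x)" if "continuous_on {0..} x" for x
    unfolding E_def using k by (intro continuous_intros continuous_on_powr' slope_continuous_on that N) auto
  let ?D = "\<lambda>t. c * B * F (w t) - (E y t + E z t)"
  have "?D 0 \<le> ?D R"
  \<comment> \<open>The derivative is required only inside the interval; at \<open>0\<close>, where
    the real power need not be differentiable, continuity suffices.\<close>
  proof (rule DERIV_nonneg_imp_increasing_open [of 0 R ?D])
    show "0 \<le> R" using R by simp
    have "continuous_on {0..R} (\<lambda>t. F (w t))"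
      by (rule continuous_on_compose2 [OF Fc continuous_on_subset [OF wc]]) (use wpos in auto)
    then show "continuous_on {0..R} ?D"
      by (intro continuous_intros continuous_on_subset [OF Ec [OF y]] continuous_on_subset [OF Ec [OF z]]) auto
    fix t assume t: "0 < t" "t < R"
    let ?v = "t powr (real N + real N / real k - 2)"
    have "(w has_real_derivative t * slope N k y t + t * slope N k z t) (at t)"
      unfolding w_def by (intro DERIV_add profile_deriv y z N t)
    then have "((\<lambda>t. F (w t)) has_real_derivative \<Phi> (w t) * (t * slope N k y t + t * slope N k z t)) (at t)"
      using wpos [of t] t by (intro DERIV_chain2 [OF F]) auto
    then have D: "(?D has_real_derivative c * B * (\<Phi> (w t) * (t * slope N k y t + t * slope N k z t))
        - (c * (?v * y t) * (t * slope N k y t) + c * (?v * z t) * (t * slope N k z t))) (at t)"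
      unfolding E_def c_def
      by (intro DERIV_diff DERIV_add DERIV_cmult slope_energy_deriv y z ypos zpos k t) auto
    have bnd: "c * (?v * x t) * (t * slope N k x t) \<le> c * (B * \<Phi> (w t)) * (t * slope N k x t)"
      if x: "continuous_on {0..} x" "\<And>t. t \<ge> 0 \<Longrightarrow> x t > 0" and xP: "x t \<le> P t * \<Phi> (w t)" for x
    proof -
      have "?v * x t \<le> ?v * (P t * \<Phi> (w t))"
        using xP by (intro mult_left_mono) auto
      also have "\<dots> \<le> B * \<Phi> (w t)"
        using W [of t] t \<Phi> [of "w t"] wpos [of t] unfolding mult.assoc [symmetric]
        by (intro mult_right_mono) auto
      finally have "?v * x t \<le> B * \<Phi> (w t)" .
      moreover have "t * slope N k x t \<ge> 0"
        using slope_nonneg [OF k(1) N x(1), of t] x(2) t by (intro mult_nonneg_nonneg) (auto simp: less_imp_le)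
      ultimately show ?thesis using c by (intro mult_right_mono mult_left_mono) auto
    qed
    have "0 \<le> c * B * (\<Phi> (w t) * (t * slope N k y t + t * slope N k z t))
        - (c * (?v * y t) * (t * slope N k y t) + c * (?v * z t) * (t * slope N k z t))"
      using bnd [OF y ypos] bnd [OF z zpos] yP [of t] zP [of t] t unfolding w_def by (simp add: algebra_simps)
    with D show "\<exists>d. (?D has_real_derivative d) (at t) \<and> 0 \<le> d" by blast
  qed
  moreover have "E x 0 = 0" for x
    by (simp add: E_def)
  \<comment> \<open>The sign of \<open>P R\<close> is forced by
    \<open>0 < y R \<le> P R * \<Phi> (w R)\<close>, and the bound on the weight at \<open>R\<close>
    then gives that of \<open>B\<close>.\<close>
  moreover have "B \<ge> 0"
  proof -
    have "0 < P R * \<Phi> (w R)" using yP [of R] ypos [of R] R by (simp add: w_def)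
    then have "0 \<le> P R" using \<Phi> [of "w R"] wpos [of R] R by (auto simp: zero_less_mult_iff)
    then have "0 \<le> R powr (real N + real N / real k - 2) * P R" by simp
    with W [of R] R show ?thesis by simp
  qed
  moreover from this have "0 \<le> c * B * F (w 0)"
    using F0 c by (simp add: w_def)
  ultimately have "0 \<le> ?D R" by simp
  then show ?thesis by (simp add: E_def w_def c_def)
qed

text \<open>Quasi-monotonicity of the weight allows \<open>B\<close> in the energy bound to be
  \<open>K\<close> times its value at \<open>r\<close>. Each energy is nonnegative, hence separately
  below the bound; taking roots of order \<open>k + 1\<close> and adding the two estimates produces
  the factor \<open>2\<close>.\<close>

lemma slope_growth:
  fixes y z :: "real \<Rightarrow> real"
  assumes k: "1 \<le> k" "k \<le> N"
    and y: "continuous_on {0..} y" and ypos: "\<And>t. t \<ge> 0 \<Longrightarrow> y t > 0"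
    and z: "continuous_on {0..} z" and zpos: "\<And>t. t \<ge> 0 \<Longrightarrow> z t > 0"
    and F: "\<And>t. t > 0 \<Longrightarrow> (F has_real_derivative \<Phi> t) (at t)"
    and F0: "F (a + b) \<ge> 0" and ab: "a + b > 0"
    and yP: "\<And>t. t > 0 \<Longrightarrow> y t \<le> P t * \<Phi> (profile N k a y t + profile N k b z t)"
    and zP: "\<And>t. t > 0 \<Longrightarrow> z t \<le> P t * \<Phi> (profile N k a y t + profile N k b z t)"
    and \<Phi>: "\<And>t. t > 0 \<Longrightarrow> \<Phi> t \<ge> 0"
    and W: "\<And>s r. 0 < s \<Longrightarrow> s \<le> r \<Longrightarrow> s powr (real N + real N / real k - 2) * P s
               \<le> K * (r powr (real N + real N / real k - 2) * P r)"
    and r: "r > 0"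
  shows "r * slope N k y r + r * slope N k z r
     \<le> 2 * root (k + 1) (K / real ((N - 1) choose (k - 1)))
         * root (k + 1) (r ^ (k - 1) * P r)
         * root (k + 1) (real (k + 1) * F (profile N k a y r + profile N k b z r))"
proof -
  let ?w = "profile N k a y r + profile N k b z r"
  define \<nu> where "\<nu> = real N / real k"
  define b where "b = real ((N - 1) choose (k - 1))"
  have N: "N \<ge> 1" using k by simp
  define Q where "Q = (real k + 1) / b * (K * (r powr (real N + \<nu> - 2) * P r)) * F ?w"
  have E: "(r powr \<nu> * slope N k y r) ^ (k + 1) + (r powr \<nu> * slope N k z r) ^ (k + 1) \<le> Q"
    unfolding Q_def \<nu>_def b_def
    by (rule slope_energy_bound [where \<Phi> = \<Phi> and P = P]) (use assms in auto)
  \<comment> \<open>Since \<open>\<nu> * k = N\<close>, the weight contains exactly the power of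
    \<open>r\<close> to be cancelled from the energies, and \<open>r ^ (k - 1)\<close>
    remains.\<close>
  have powr: "r powr (real N + \<nu> - 2) = (r powr (\<nu> - 1)) ^ (k + 1) * r ^ (k - 1)"
  proof -
    have "(r powr (\<nu> - 1)) ^ (k + 1) = r powr ((\<nu> - 1) * real (k + 1))"
      using r by (subst powr_realpow [symmetric]) (simp_all add: powr_powr)
    then have "(r powr (\<nu> - 1)) ^ (k + 1) * r ^ (k - 1) = r powr ((\<nu> - 1) * real (k + 1)) * r powr real (k - 1)"
      using r by (simp only: powr_realpow)
    also have "\<dots> = r powr ((\<nu> - 1) * real (k + 1) + real (k - 1))"
      by (simp add: powr_add)
    also have "(\<nu> - 1) * real (k + 1) + real (k - 1) = real N + \<nu> - 2"
      using k by (simp add: \<nu>_def of_nat_diff field_simps)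
    finally show ?thesis by simp
  qed
  have each: "r * slope N k x r
     \<le> root (k + 1) (K / b) * root (k + 1) (r ^ (k - 1) * P r) * root (k + 1) (real (k + 1) * F ?w)"
    if nn: "slope N k x r \<ge> 0" and E: "(r powr \<nu> * slope N k x r) ^ (k + 1) \<le> Q" for x
  proof -
    have "r powr \<nu> = r powr (\<nu> - 1) * r" using r by (simp add: powr_diff)
    then have "(r powr (\<nu> - 1)) ^ (k + 1) * (r * slope N k x r) ^ (k + 1)
        \<le> (r powr (\<nu> - 1)) ^ (k + 1) * (K / b * (r ^ (k - 1) * P r) * (real (k + 1) * F ?w))"
      using E unfolding Q_def powr by (simp only: power_mult_distrib [symmetric]) (simp add: ac_simps)
    then have "(r * slope N k x r) ^ (k + 1) \<le> K / b * (r ^ (k - 1) * P r) * (real (k + 1) * F ?w)"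
      using r by (simp only: mult_le_cancel_left) auto
    then have "root (k + 1) ((r * slope N k x r) ^ (k + 1))
        \<le> root (k + 1) (K / b * (r ^ (k - 1) * P r) * (real (k + 1) * F ?w))"
      by (intro real_root_le_mono) auto
    moreover have "root (k + 1) ((r * slope N k x r) ^ (k + 1)) = r * slope N k x r"
      using r nn by (intro real_root_power_cancel) auto
    ultimately show ?thesis by (simp only: real_root_mult)
  qed
  have nn: "slope N k y r \<ge> 0" "slope N k z r \<ge> 0"
    by (rule slope_nonneg [OF k(1) N y less_imp_le [OF r] less_imp_le [OF ypos]],
        assumption,
        rule slope_nonneg [OF k(1) N z less_imp_le [OF r] less_imp_le [OF zpos]])
  have "(r powr \<nu> * slope N k x r) ^ (k + 1) \<ge> 0" if "slope N k x r \<ge> 0" for x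
    using that by simp
  from this [OF nn(1)] this [OF nn(2)] E
  have "r * slope N k y r + r * slope N k z r
     \<le> 2 * (root (k + 1) (K / b) * root (k + 1) (r ^ (k - 1) * P r) * root (k + 1) (real (k + 1) * F ?w))"
    using each [OF nn(1)] each [OF nn(2)] by linarith
  then show ?thesis by (simp add: b_def mult_ac)
qed

subsection \<open>Uniform bound and monotone iteration\<close>

text \<open>The growth estimate is a separable inequality: with \<open>w\<close> the sum of the
  profiles, \<open>\<phi> w * w' \<le> C * h\<close>. Integration bounds the integral of
  \<open>\<phi>\<close> from \<open>a + b\<close> to \<open>w r\<close> by \<open>C * L\<close>,
  whereas \<open>M\<close> was chosen so that the integral up to \<open>M\<close> already exceeds
  \<open>C * L\<close>.\<close>

lemma profile_sum_bounded:
  fixes y z :: "real \<Rightarrow> real"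
  assumes k: "1 \<le> k" "k \<le> N"
    and y: "continuous_on {0..} y" and ypos: "\<And>t. t \<ge> 0 \<Longrightarrow> y t > 0"
    and z: "continuous_on {0..} z" and zpos: "\<And>t. t \<ge> 0 \<Longrightarrow> z t > 0"
    and F: "\<And>t. t > 0 \<Longrightarrow> (F has_real_derivative \<Phi> t) (at t)"
    and Fpos: "\<And>t. t > 0 \<Longrightarrow> F t > 0" and ab: "a + b > 0"
    and yP: "\<And>t. t > 0 \<Longrightarrow> y t \<le> P t * \<Phi> (profile N k a y t + profile N k b z t)"
    and zP: "\<And>t. t > 0 \<Longrightarrow> z t \<le> P t * \<Phi> (profile N k a y t + profile N k b z t)"
    and \<Phi>: "\<And>t. t > 0 \<Longrightarrow> \<Phi> t \<ge> 0"
    and P: "continuous_on {0..} P"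
    and W: "\<And>s r. 0 < s \<Longrightarrow> s \<le> r \<Longrightarrow> s powr (real N + real N / real k - 2) * P s
               \<le> K * (r powr (real N + real N / real k - 2) * P r)"
    and K: "K \<ge> 0"
    and L: "\<And>r. r \<ge> 0 \<Longrightarrow> integral {0..r} (\<lambda>t. root (k + 1) (t ^ (k - 1) * P t)) \<le> L"
    and M: "M \<ge> a + b"
      "2 * root (k + 1) (K / real ((N - 1) choose (k - 1))) * L
        < integral {a + b..M} (\<lambda>t. 1 / root (k + 1) (real (k + 1) * F t))"
    and r: "r \<ge> 0"
  shows "profile N k a y r + profile N k b z r \<le> M"
proof (rule ccontr)
  define w where "w t = profile N k a y t + profile N k b z t" for t
  define h where "h t = root (k + 1) (t ^ (k - 1) * P t)" for t
  define \<phi> where "\<phi> t = 1 / root (k + 1) (real (k + 1) * F t)" for t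
  define C where "C = 2 * root (k + 1) (K / real ((N - 1) choose (k - 1)))"
  \<comment> \<open>integrating from a point below \<open>w 0 = a + b\<close> makes the primitive of \<open>\<phi>\<close> differentiable at every \<open>w t\<close>\<close>
  define d where "d = (a + b) / 2"
  have d: "0 < d" "d < a + b" using ab by (auto simp: d_def)
  assume "\<not> profile N k a y r + profile N k b z r \<le> M"
  then have wM: "M < w r" by (simp add: w_def)
  have N: "N \<ge> 1" using k by simp
  have C: "C \<ge> 0" using K by (simp add: C_def)
  have w: "w t \<ge> a + b" if "t \<ge> 0" for t
    using profile_ge [OF k(1) N y that less_imp_le [OF ypos], of a]
      profile_ge [OF k(1) N z that less_imp_le [OF zpos], of b] by (simp add: w_def)
  have wc: "continuous_on {0..} w"
    unfolding w_def by (intro continuous_intros profile_continuous_on y z N)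
  have hc: "continuous_on {0..} h"
    unfolding h_def by (intro continuous_intros P)
  have root_pos: "root (k + 1) (real (k + 1) * F t) > 0" if "t > 0" for t
    using Fpos [OF that] by simp
  have "continuous_on {0<..} F"
    by (rule DERIV_continuous_on, rule has_field_derivative_at_within, rule F) auto
  then have \<phi>c: "continuous_on {0<..} \<phi>"
    unfolding \<phi>_def using root_pos by (intro continuous_intros) (force simp: less_le)+
  have \<phi>i: "\<phi> integrable_on {s..t}" if "s > 0" for s t
    by (intro integrable_continuous_real continuous_on_subset [OF \<phi>c]) (use that in auto)
  have \<phi>pos: "\<phi> t > 0" if "t > 0" for t
    using root_pos [OF that] by (simp add: \<phi>_def)
  have \<Psi>: "((\<lambda>x. integral {d..x} \<phi>) has_real_derivative \<phi> x) (at x)" if x: "x > d" for x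
  proof -
    have "((\<lambda>x. integral {d..x} \<phi>) has_real_derivative \<phi> x) (at x within {d..x + 1})"
      by (rule integral_has_real_derivative) (use x d in \<open>auto intro: continuous_on_subset [OF \<phi>c]\<close>)
    moreover have "at x within {d..x + 1} = at x"
      by (rule at_within_interior) (use x in auto)
    ultimately show ?thesis by simp
  qed
  have h_deriv: "((\<lambda>x. integral {0..x} h) has_real_derivative h x) (at x)" if "x > 0" for x
    using integral_power_mult_deriv [OF hc that, of 0] by simp
  let ?D = "\<lambda>t. C * integral {0..t} h - integral {d..w t} \<phi>"
  have "?D 0 \<le> ?D r"
  proof (rule DERIV_nonneg_imp_increasing_open [of 0 r ?D])
    show "0 \<le> r" by (rule r)
    have "continuous_on {d<..} (\<lambda>x. integral {d..x} \<phi>)"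
      by (rule DERIV_continuous_on, rule has_field_derivative_at_within, rule \<Psi>) auto
    then have "continuous_on {0..r} (\<lambda>t. integral {d..w t} \<phi>)"
      by (rule continuous_on_compose2 [OF _ continuous_on_subset [OF wc]]) (use w d in force)+
    moreover have "continuous_on {0..r} (\<lambda>t. integral {0..t} h)"
      by (intro indefinite_integral_continuous_1 integrable_continuous_real continuous_on_subset [OF hc]) auto
    ultimately show "continuous_on {0..r} ?D"
      by (intro continuous_intros)
    fix t assume t: "0 < t" "t < r"
    let ?w' = "t * slope N k y t + t * slope N k z t"
    have "(w has_real_derivative ?w') (at t)"
      unfolding w_def by (intro DERIV_add profile_deriv y z N t)
    then have "((\<lambda>t. integral {d..w t} \<phi>) has_real_derivative \<phi> (w t) * ?w') (at t)"
      using w [of t] t d by (intro DERIV_chain2 [OF \<Psi>]) auto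
    then have D: "(?D has_real_derivative C * h t - \<phi> (w t) * ?w') (at t)"
      by (intro DERIV_diff DERIV_cmult h_deriv t)
    have wt: "w t > 0" using w [of t] t ab by simp
    have "?w' \<le> C * h t * root (k + 1) (real (k + 1) * F (w t))"
      unfolding C_def h_def w_def
      by (rule slope_growth [where \<Phi> = \<Phi>, OF k y ypos z zpos F less_imp_le [OF Fpos [OF ab]] ab yP zP \<Phi> W t(1)])
    then have "\<phi> (w t) * ?w' \<le> \<phi> (w t) * (C * h t * root (k + 1) (real (k + 1) * F (w t)))"
      using \<phi>pos [OF wt] by (intro mult_left_mono) auto
    also have "\<dots> = C * h t"
      using Fpos [OF wt] by (simp add: \<phi>_def)
    finally have "0 \<le> C * h t - \<phi> (w t) * ?w'" by simp
    with D show "\<exists>y. (?D has_real_derivative y) (at t) \<and> 0 \<le> y" by blast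
  qed
  \<comment> \<open>At \<open>t = 0\<close> the first term of \<open>?D\<close> vanishes and
    \<open>w 0 = a + b\<close>.\<close>
  then have "integral {d..w r} \<phi> - integral {d..a + b} \<phi> \<le> C * integral {0..r} h"
    by (simp add: w_def)
  moreover have "C * integral {0..r} h \<le> C * L"
    using L [OF r] C unfolding h_def by (rule mult_left_mono)
  moreover have "integral {d..w r} \<phi> = integral {d..a + b} \<phi> + integral {a + b..w r} \<phi>"
    using w [OF r] d by (intro Henstock_Kurzweil_Integration.integral_combine [symmetric] \<phi>i) auto
  moreover have "integral {a + b..M} \<phi> \<le> integral {a + b..w r} \<phi>"
    by (intro integral_subset_le \<phi>i) (use wM ab less_imp_le [OF \<phi>pos] in auto)
  moreover have "C * L < integral {a + b..M} \<phi>"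
    using M(2) unfolding C_def \<phi>_def [abs_def] .
  ultimately show False by linarith
qed

text \<open>Integrability is stated separately: the limit \<open>z\<close> is not known to be continuous when this is applied.\<close>

lemma profile_tendsto:
  fixes zs :: "nat \<Rightarrow> real \<Rightarrow> real"
  assumes zs: "\<And>m. continuous_on {0..} (zs m)" and k: "1 \<le> k" and N: "1 \<le> N"
    and nonneg: "\<And>m t. 0 \<le> t \<Longrightarrow> t \<le> r \<Longrightarrow> 0 \<le> zs m t"
    and bnd: "\<And>m t. 0 \<le> t \<Longrightarrow> t \<le> r \<Longrightarrow> zs m t \<le> b"
    and lim: "\<And>t. 0 \<le> t \<Longrightarrow> t \<le> r \<Longrightarrow> (\<lambda>m. zs m t) \<longlonglongrightarrow> z t"
  shows "(\<lambda>m. profile N k a (zs m) r) \<longlonglongrightarrow> profile N k a z r"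
    and "(\<lambda>s. s * slope N k z s) integrable_on {0..r}"
proof -
  let ?c = "real k / real ((N - 1) choose (k - 1))"
  \<comment> \<open>A dominating constant on \<open>{0..r}\<close>: \<open>s\<close> is at most
    \<open>r\<close>, and a right-hand side below \<open>b\<close> has mean at most
    \<open>b / N\<close>.\<close>
  let ?b = "r * root k (?c * (b / real N))"
  have int: "(\<lambda>s. s * slope N k (zs m) s) integrable_on {0..r}" for m
    by (rule slope_mult_integrable [OF zs N])
  have const: "(\<lambda>s::real. ?b) integrable_on {0..r}"
    by (intro integrable_continuous_real continuous_intros)
  have le: "norm (s * slope N k (zs m) s) \<le> ?b" if s: "s \<in> {0..r}" for m s
  proof -
    have nn: "0 \<le> slope N k (zs m) s"
      by (rule slope_nonneg [OF k N zs]) (use s nonneg in auto)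
    have "avg N (zs m) s \<le> b / real N"
      by (rule avg_le [OF zs N]) (use s bnd in auto)
    then have "slope N k (zs m) s \<le> root k (?c * (b / real N))"
      unfolding slope_def using k by (intro real_root_le_mono mult_left_mono) auto
    then have "s * slope N k (zs m) s \<le> ?b"
      using s nn by (intro mult_mono) auto
    then show ?thesis using s nn by simp
  qed
  have conv: "(\<lambda>m. s * slope N k (zs m) s) \<longlonglongrightarrow> s * slope N k z s" if s: "s \<in> {0..r}" for s
  proof -
    have "(\<lambda>m. avg N (zs m) s) \<longlonglongrightarrow> avg N z s"
      by (rule avg_tendsto [OF zs, where b = b]) (use s nonneg bnd lim in auto)
    then show ?thesis
      unfolding slope_def by (intro tendsto_mult_left tendsto_real_root)
  qed
  show "(\<lambda>s. s * slope N k z s) integrable_on {0..r}"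
    by (rule dominated_convergence(1) [OF int const le conv])
  have "(\<lambda>m. integral {0..r} (\<lambda>s. s * slope N k (zs m) s)) \<longlonglongrightarrow> integral {0..r} (\<lambda>s. s * slope N k z s)"
    by (rule dominated_convergence(2) [OF int const le conv])
  then show "(\<lambda>m. profile N k a (zs m) r) \<longlonglongrightarrow> profile N k a z r"
    unfolding profile_def by (intro tendsto_add tendsto_const)
qed

section \<open>Monotone iteration for the system\<close>

lemma continuous_on_atLeast_integral:
  fixes f :: "real \<Rightarrow> real"
  assumes "\<And>r. f integrable_on {a..r}"
  shows "continuous_on {a..} (\<lambda>r. integral {a..r} f)"
  unfolding continuous_on_eq_continuous_within
proof
  fix s assume s: "s \<in> {a..}"
  have "continuous_on {a..s + 1} (\<lambda>r. integral {a..r} f)"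
    by (rule indefinite_integral_continuous_1 [OF assms])
  then have "continuous (at s within {a..s + 1}) (\<lambda>r. integral {a..r} f)"
    using s by (auto simp: continuous_on_eq_continuous_within)
  moreover have "at s within {a..s + 1} = at s within {a..}"
    by (rule at_within_nhd [where S = "{..<s + 1}"]) auto
  ultimately show "continuous (at s within {a..}) (\<lambda>r. integral {a..r} f)" by simp
qed

text \<open>Starting from the constants \<open>a\<close> and \<open>b\<close>, monotonicity of
  \<open>f\<close> and \<open>g\<close> makes the iterates increase. Each iterate therefore lies
  below its own image, which is what \<open>bound\<close> asks for, so \<open>M\<close> bounds the
  whole sequence. The pointwise limits satisfy the integral equations by dominated
  convergence.\<close>

lemma radial_system_solution:
  fixes p q :: "real \<Rightarrow> real" and f g :: "real \<Rightarrow> real \<Rightarrow> real"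
  assumes k: "1 \<le> k" and N: "1 \<le> N" and ab: "a \<ge> 0" "b \<ge> 0"
    and p: "continuous_on {0..} p" "\<And>r. r \<ge> 0 \<Longrightarrow> p r \<ge> 0"
    and q: "continuous_on {0..} q" "\<And>r. r \<ge> 0 \<Longrightarrow> q r \<ge> 0"
    and f: "continuous_on ({0..} \<times> {0..}) (\<lambda>(s, t). f s t)" "\<And>s t. s \<ge> 0 \<Longrightarrow> t \<ge> 0 \<Longrightarrow> f s t \<ge> 0"
    and g: "continuous_on ({0..} \<times> {0..}) (\<lambda>(s, t). g s t)" "\<And>s t. s \<ge> 0 \<Longrightarrow> t \<ge> 0 \<Longrightarrow> g s t \<ge> 0"
    and f_mono: "\<And>s t s' t'. 0 \<le> s \<Longrightarrow> s \<le> s' \<Longrightarrow> 0 \<le> t \<Longrightarrow> t \<le> t' \<Longrightarrow> f s t \<le> f s' t'"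
    and g_mono: "\<And>s t s' t'. 0 \<le> s \<Longrightarrow> s \<le> s' \<Longrightarrow> 0 \<le> t \<Longrightarrow> t \<le> t' \<Longrightarrow> g s t \<le> g s' t'"
  defines "U \<equiv> \<lambda>u v. profile N k a (\<lambda>t. (p t * f (u t) (v t)) ^ k)"
    and "V \<equiv> \<lambda>u v. profile N k b (\<lambda>t. (q t * g (u t) (v t)) ^ k)"
  assumes bound: "\<And>u v r. continuous_on {0..} u \<Longrightarrow> continuous_on {0..} v \<Longrightarrow>
      (\<And>t. t \<ge> 0 \<Longrightarrow> a \<le> u t \<and> u t \<le> U u v t) \<Longrightarrow> (\<And>t. t \<ge> 0 \<Longrightarrow> b \<le> v t \<and> v t \<le> V u v t) \<Longrightarrow>
      r \<ge> 0 \<Longrightarrow> U u v r + V u v r \<le> M"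
  obtains u v where "continuous_on {0..} u" and "continuous_on {0..} v"
    and "\<And>r. r \<ge> 0 \<Longrightarrow> a \<le> u r \<and> u r \<le> M" and "\<And>r. r \<ge> 0 \<Longrightarrow> b \<le> v r \<and> v r \<le> M"
    and "\<And>r. r \<ge> 0 \<Longrightarrow> u r = U u v r" and "\<And>r. r \<ge> 0 \<Longrightarrow> v r = V u v r"
proof -
  define X where "X n = ((\<lambda>(u, v). (U u v, V u v)) ^^ n) (\<lambda>_. a, \<lambda>_. b)" for n
  define u where "u n = fst (X n)" for n
  define v where "v n = snd (X n)" for n
  have init: "u 0 = (\<lambda>_. a)" "v 0 = (\<lambda>_. b)"
    by (simp_all add: u_def v_def X_def)
  have step: "u (Suc n) = U (u n) (v n)" "v (Suc n) = V (u n) (v n)" for n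
    by (simp_all add: u_def v_def X_def case_prod_beta)
  let ?y = "\<lambda>u v t. (p t * f (u t) (v t)) ^ k" and ?z = "\<lambda>u v t. (q t * g (u t) (v t)) ^ k"
  have rhs_cont: "continuous_on {0..} (?y u v)" "continuous_on {0..} (?z u v)"
    if "continuous_on {0..} u" "continuous_on {0..} v"
      "\<And>t. t \<ge> 0 \<Longrightarrow> a \<le> u t" "\<And>t. t \<ge> 0 \<Longrightarrow> b \<le> v t" for u v
  proof -
    have pair: "continuous_on {0..} (\<lambda>t. (u t, v t))" "(\<lambda>t. (u t, v t)) ` {0..} \<subseteq> {0..} \<times> {0..}"
      using that ab by (auto intro!: continuous_intros intro: order_trans)
    show "continuous_on {0..} (?y u v)" "continuous_on {0..} (?z u v)"
      using continuous_on_compose2 [OF f(1) pair] continuous_on_compose2 [OF g(1) pair]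
      by (auto intro!: continuous_intros p(1) q(1))
  qed
  have rhs_nonneg: "0 \<le> ?y u v t" "0 \<le> ?z u v t" if "t \<ge> 0" "a \<le> u t" "b \<le> v t" for u v t
    using that ab p(2) [of t] q(2) [of t] f(2) [of "u t" "v t"] g(2) [of "u t" "v t"] by auto
  have rhs_mono: "?y u v t \<le> ?y u' v' t" "?z u v t \<le> ?z u' v' t"
    if "t \<ge> 0" "a \<le> u t" "b \<le> v t" "u t \<le> u' t" "v t \<le> v' t" for u v u' v' t
    using that ab p(2) [of t] q(2) [of t] f(2) [of "u t" "v t"] g(2) [of "u t" "v t"]
      f_mono [of "u t" "u' t" "v t" "v' t"] g_mono [of "u t" "u' t" "v t" "v' t"]
    by (auto intro!: power_mono mult_left_mono)
  have step_mono: "U u v t \<le> U u' v' t \<and> V u v t \<le> V u' v' t"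
    if cont: "continuous_on {0..} u" "continuous_on {0..} v" "continuous_on {0..} u'" "continuous_on {0..} v'"
      and ge: "\<And>t. t \<ge> 0 \<Longrightarrow> a \<le> u t" "\<And>t. t \<ge> 0 \<Longrightarrow> b \<le> v t"
      and le: "\<And>t. t \<ge> 0 \<Longrightarrow> u t \<le> u' t" "\<And>t. t \<ge> 0 \<Longrightarrow> v t \<le> v' t" and t: "t \<ge> 0"
    for u v u' v' t
  proof -
    have ge': "a \<le> u' t" "b \<le> v' t" if "t \<ge> 0" for t
      using ge [OF that] le [OF that] by simp_all
    show ?thesis
      unfolding U_def V_def
      by (intro conjI profile_mono k N t rhs_cont rhs_mono cont ge ge' le)
  qed
  have inv: "continuous_on {0..} (u n) \<and> continuous_on {0..} (v n) \<and>
      (\<forall>t\<ge>0. a \<le> u n t \<and> b \<le> v n t \<and> u n t \<le> u (Suc n) t \<and> v n t \<le> v (Suc n) t)" for n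
  proof (induction n)
    case 0
    have "a \<le> u 1 t" "b \<le> v 1 t" if "t \<ge> 0" for t
      unfolding One_nat_def step U_def V_def
      by (rule profile_ge [OF k N rhs_cont(1) that] profile_ge [OF k N rhs_cont(2) that];
          (intro rhs_nonneg)?; simp add: init)+
    then show ?case by (simp add: init)
  next
    case (Suc n)
    have c: "continuous_on {0..} (u (Suc n))" "continuous_on {0..} (v (Suc n))"
      unfolding step U_def V_def using Suc by (auto intro!: profile_continuous_on N rhs_cont)
    have ge: "a \<le> u (Suc n) t" "b \<le> v (Suc n) t" if "t \<ge> 0" for t
      using Suc that by (auto intro: order_trans)
    have "U (u n) (v n) t \<le> U (u (Suc n)) (v (Suc n)) t \<and> V (u n) (v n) t \<le> V (u (Suc n)) (v (Suc n)) t"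
      if "t \<ge> 0" for t
      by (rule step_mono) (use Suc c ge that in auto)
    then have "u (Suc n) t \<le> u (Suc (Suc n)) t \<and> v (Suc n) t \<le> v (Suc (Suc n)) t" if "t \<ge> 0" for t
      using that by (simp only: step)
    then show ?case using c ge by blast
  qed
  have cont: "continuous_on {0..} (u n)" "continuous_on {0..} (v n)" for n
    using inv by auto
  have ge: "a \<le> u n t" "b \<le> v n t" if "t \<ge> 0" for n t
    using inv [of n] that by auto
  have incr: "u n t \<le> u (Suc n) t" "v n t \<le> v (Suc n) t" if "t \<ge> 0" for n t
    using inv [of n] that by auto
  have sum: "u (Suc n) t + v (Suc n) t \<le> M" if "t \<ge> 0" for n t
    unfolding step using ge incr by (intro bound cont that) (auto simp: step [symmetric])
  \<comment> \<open>The bound on the sum at stage \<open>Suc n\<close> controls each component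
    because the other one is nonnegative.\<close>
  have le: "u n t \<le> M" "v n t \<le> M" if "t \<ge> 0" for n t
    using sum [OF that, of n] ge [OF that, of "Suc n"] incr [OF that, of n] ab by linarith+
  have "\<exists>l. (\<lambda>n. u n t) \<longlonglongrightarrow> l" "\<exists>l. (\<lambda>n. v n t) \<longlonglongrightarrow> l" if "t \<ge> 0" for t
  proof -
    have "incseq (\<lambda>n. u n t)" "incseq (\<lambda>n. v n t)"
      using incr [OF that] by (simp_all add: incseq_Suc_iff)
    then show "\<exists>l. (\<lambda>n. u n t) \<longlonglongrightarrow> l" "\<exists>l. (\<lambda>n. v n t) \<longlonglongrightarrow> l"
      using le [OF that] incseq_convergent by meson+
  qed
  then obtain u' v' where lim: "\<And>t. t \<ge> 0 \<Longrightarrow> (\<lambda>n. u n t) \<longlonglongrightarrow> u' t" "\<And>t. t \<ge> 0 \<Longrightarrow> (\<lambda>n. v n t) \<longlonglongrightarrow> v' t"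
    by metis
  have u'_bounds: "a \<le> u' t" "u' t \<le> M" and v'_bounds: "b \<le> v' t" "v' t \<le> M" if "t \<ge> 0" for t
    using ge [OF that] le [OF that] lim [OF that] by (auto intro: LIMSEQ_le_const LIMSEQ_le_const2)
  have rhs_lim: "(\<lambda>n. ?y (u n) (v n) t) \<longlonglongrightarrow> ?y u' v' t" "(\<lambda>n. ?z (u n) (v n) t) \<longlonglongrightarrow> ?z u' v' t"
    if t: "t \<ge> 0" for t
  proof -
    have pair: "(\<lambda>n. (u n t, v n t)) \<longlonglongrightarrow> (u' t, v' t)"
      by (intro tendsto_Pair lim t)
    have in_quad: "(u' t, v' t) \<in> {0..} \<times> {0..}" "\<forall>\<^sub>F n in sequentially. (u n t, v n t) \<in> {0..} \<times> {0..}"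
      using u'_bounds [OF t] v'_bounds [OF t] order_trans [OF ab(1) ge(1) [OF t]] order_trans [OF ab(2) ge(2) [OF t]] ab
      by auto
    have fg: "(\<lambda>n. f (u n t) (v n t)) \<longlonglongrightarrow> f (u' t) (v' t)" "(\<lambda>n. g (u n t) (v n t)) \<longlonglongrightarrow> g (u' t) (v' t)"
      using continuous_on_tendsto_compose [OF f(1) pair in_quad]
        continuous_on_tendsto_compose [OF g(1) pair in_quad] by simp_all
    show "(\<lambda>n. ?y (u n) (v n) t) \<longlonglongrightarrow> ?y u' v' t" "(\<lambda>n. ?z (u n) (v n) t) \<longlonglongrightarrow> ?z u' v' t"
      by (intro tendsto_power tendsto_mult_left fg)+
  qed
  \<comment> \<open>A bound uniform in \<open>n\<close> on each compact interval: by monotonicity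
    the right-hand sides are largest when both arguments are replaced by \<open>M\<close>.\<close>
  have rhs_bounded: "\<exists>B. \<forall>t\<in>{0..r}. \<forall>n. ?y (u n) (v n) t \<le> B \<and> ?z (u n) (v n) t \<le> B" for r
  proof -
    let ?s = "\<lambda>t. (p t * f M M) ^ k + (q t * g M M) ^ k"
    have "bounded (?s ` {0..r})"
      by (intro compact_imp_bounded compact_continuous_image continuous_intros continuous_on_subset [OF p(1)]
          continuous_on_subset [OF q(1)]) auto
    then obtain B where "\<forall>x\<in>?s ` {0..r}. norm x \<le> B"
      unfolding bounded_iff by blast
    then have B: "?s t \<le> B" if "t \<in> {0..r}" for t
      using that by (auto simp: abs_le_iff)
    have "?y (u n) (v n) t \<le> B \<and> ?z (u n) (v n) t \<le> B" if t: "t \<in> {0..r}" for n t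
    proof -
      have t0: "t \<ge> 0" using t by simp
      have "?y (u n) (v n) t \<le> ?y (\<lambda>_. M) (\<lambda>_. M) t" "?z (u n) (v n) t \<le> ?z (\<lambda>_. M) (\<lambda>_. M) t"
        using rhs_mono [of t "u n" "v n" "\<lambda>_. M" "\<lambda>_. M"] t0 ge le by simp_all
      moreover have "0 \<le> ?y (\<lambda>_. M) (\<lambda>_. M) t" "0 \<le> ?z (\<lambda>_. M) (\<lambda>_. M) t"
        using rhs_nonneg [of t "\<lambda>_. M" "\<lambda>_. M"] t0
          order_trans [OF ge(1) le(1), OF t0 t0] order_trans [OF ge(2) le(2), OF t0 t0] by simp_all
      ultimately show ?thesis using B [OF t] by linarith
    qed
    then show ?thesis by blast
  qed
  have lim_profile:
    "(\<lambda>n. U (u n) (v n) r) \<longlonglongrightarrow> U u' v' r \<and> (\<lambda>s. s * slope N k (?y u' v') s) integrable_on {0..r}"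
    "(\<lambda>n. V (u n) (v n) r) \<longlonglongrightarrow> V u' v' r \<and> (\<lambda>s. s * slope N k (?z u' v') s) integrable_on {0..r}" for r
  proof -
    obtain B where B: "\<And>t n. t \<in> {0..r} \<Longrightarrow> ?y (u n) (v n) t \<le> B \<and> ?z (u n) (v n) t \<le> B"
      using rhs_bounded by blast
    have y: "continuous_on {0..} (?y (u n) (v n))" and z: "continuous_on {0..} (?z (u n) (v n))" for n
      by (rule rhs_cont; use cont ge in simp)+
    have nn: "0 \<le> ?y (u n) (v n) t" "0 \<le> ?z (u n) (v n) t" if "t \<ge> 0" for n t
      using rhs_nonneg [of t "u n" "v n"] ge [OF that] that by simp_all
    show "(\<lambda>n. U (u n) (v n) r) \<longlonglongrightarrow> U u' v' r \<and> (\<lambda>s. s * slope N k (?y u' v') s) integrable_on {0..r}"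
      unfolding U_def using B nn rhs_lim
      by (intro conjI profile_tendsto [where zs = "\<lambda>n. ?y (u n) (v n)" and b = B] y k N) auto
    show "(\<lambda>n. V (u n) (v n) r) \<longlonglongrightarrow> V u' v' r \<and> (\<lambda>s. s * slope N k (?z u' v') s) integrable_on {0..r}"
      unfolding V_def using B nn rhs_lim
      by (intro conjI profile_tendsto [where zs = "\<lambda>n. ?z (u n) (v n)" and b = B] z k N) auto
  qed
  \<comment> \<open>The shifted sequence \<open>u (Suc n)\<close> has the limit \<open>u'\<close>
    and, through the recursion, also the limit \<open>U u' v'\<close>; likewise for
    \<open>v\<close>.\<close>
  have fix_u: "u' r = U u' v' r" and fix_v: "v' r = V u' v' r" if "r \<ge> 0" for r
    using LIMSEQ_Suc [OF lim(1) [OF that]] LIMSEQ_Suc [OF lim(2) [OF that]] lim_profile [of r]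
    unfolding step by (auto intro: LIMSEQ_unique)
  \<comment> \<open>A pointwise limit need not be continuous; here continuity comes from the
    fixed-point equation, whose right-hand side is an indefinite integral.\<close>
  have UV_cont: "continuous_on {0..} (U u' v')" "continuous_on {0..} (V u' v')"
    unfolding U_def V_def profile_def using lim_profile
    by (auto intro!: continuous_intros continuous_on_atLeast_integral)
  have "continuous_on {0..} u'"
    by (rule continuous_on_eq [OF UV_cont(1)]) (simp add: fix_u [symmetric])
  moreover have "continuous_on {0..} v'"
    by (rule continuous_on_eq [OF UV_cont(2)]) (simp add: fix_v [symmetric])
  ultimately show thesis
    using that [of u' v'] u'_bounds v'_bounds fix_u fix_v by blast
qed

section \<open>Assembling the existence proof\<close>

lemma integral_from_0_deriv_pos:
  fixes \<Phi> :: "real \<Rightarrow> real"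
  assumes \<Phi>: "continuous_on {0..} \<Phi>" and pos: "\<And>t. t > 0 \<Longrightarrow> \<Phi> t > 0"
    and F: "\<And>t. t \<ge> 0 \<Longrightarrow> F t = integral {0..t} \<Phi>" and t: "t > 0"
  shows "(F has_real_derivative \<Phi> t) (at t)" and "F t > 0"
proof -
  have deriv: "((\<lambda>t. integral {0..t} \<Phi>) has_real_derivative \<Phi> t) (at t)" if "t > 0" for t
    using integral_power_mult_deriv [OF \<Phi> that, of 0] by simp
  then show "(F has_real_derivative \<Phi> t) (at t)"
    by (rule has_field_derivative_transform_within_open [where S = "{0<..}"]) (use t F in auto)
  have "integral {0..0} \<Phi> < integral {0..t} \<Phi>"
  proof (rule DERIV_pos_imp_increasing_open [OF t])
    show "continuous_on {0..t} (\<lambda>t. integral {0..t} \<Phi>)"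
      by (intro indefinite_integral_continuous_1 integrable_continuous_real continuous_on_subset [OF \<Phi>]) auto
  qed (use deriv pos in blast)
  then show "F t > 0" using F [of t] t by simp
qed

theorem theorem3:
  fixes p q :: "real \<Rightarrow> real" and f g :: "real \<Rightarrow> real \<Rightarrow> real"
    and F :: "real \<Rightarrow> real" and k :: nat
  assumes N: "CARD('n::finite) \<ge> 3"
    and k: "k \<in> (if odd (CARD('n)) then {1..CARD('n) div 2} else {1..CARD('n) div 2 - 1})"
    and p_cont: "continuous_on {0..} p" and p_pos: "\<And>r. r \<ge> 0 \<Longrightarrow> p r > 0"
    and q_cont: "continuous_on {0..} q" and q_pos: "\<And>r. r \<ge> 0 \<Longrightarrow> q r > 0"
    and f_cont: "continuous_on ({0..} \<times> {0..}) (\<lambda>(s, t). f s t)"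
    and f_nonneg: "\<And>s t. s \<ge> 0 \<Longrightarrow> t \<ge> 0 \<Longrightarrow> f s t \<ge> 0"
    and g_cont: "continuous_on ({0..} \<times> {0..}) (\<lambda>(s, t). g s t)"
    and g_nonneg: "\<And>s t. s \<ge> 0 \<Longrightarrow> t \<ge> 0 \<Longrightarrow> g s t \<ge> 0"
    and weight_mono: "\<exists>R>0. mono_on {R..}
          (\<lambda>r. r powr (real (CARD('n)) + real (CARD('n)) / real k - 2) * (p r ^ k + q r ^ k))"
    and f_mono1: "\<And>t. t \<ge> 0 \<Longrightarrow> mono_on {0..} (\<lambda>s. f s t)"
    and f_mono2: "\<And>s. s \<ge> 0 \<Longrightarrow> mono_on {0..} (\<lambda>t. f s t)"
    and g_mono1: "\<And>t. t \<ge> 0 \<Longrightarrow> mono_on {0..} (\<lambda>s. g s t)"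
    and g_mono2: "\<And>s. s \<ge> 0 \<Longrightarrow> mono_on {0..} (\<lambda>t. g s t)"
    and f_zero: "f 0 0 = 0" and g_zero: "g 0 0 = 0"
    and f_pos: "\<And>s t. s > 0 \<Longrightarrow> t > 0 \<Longrightarrow> f s t > 0"
    and g_pos: "\<And>s t. s > 0 \<Longrightarrow> t > 0 \<Longrightarrow> g s t > 0"
    and F_def: "\<And>t. t \<ge> 0 \<Longrightarrow> F t = integral {0..t} (\<lambda>z. f z z ^ k + g z z ^ k)"
    and keller_osserman:
      "(\<integral>\<^sup>+t\<in>{1..}. ennreal (1 / root (k + 1) (real (k + 1) * F t)) \<partial>lborel) = \<infinity>"
    and weight_integrable: "\<exists>\<epsilon>>0.
          (\<integral>\<^sup>+t\<in>{0..}. ennreal (t powr (1 + \<epsilon> + 2 * (real k - 1) / (real k + 1)) *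
             (p t ^ k + q t ^ k) powr (2 / (real k + 1))) \<partial>lborel) < \<infinity>"
  shows "\<exists>u v :: real^'n \<Rightarrow> real. u \<in> admissible k \<and> v \<in> admissible k \<and>
           radial u \<and> radial v \<and> (\<forall>x. u x \<ge> 0) \<and> (\<forall>x. v x \<ge> 0) \<and>
           bounded (range u) \<and> bounded (range v) \<and> (\<exists>x. (u x, v x) \<noteq> (0, 0)) \<and>
           (\<forall>x. root k (elem_sym k (eigenvalues (hessian u x))) = p (norm x) * f (u x) (v x)) \<and>
           (\<forall>x. root k (elem_sym k (eigenvalues (hessian v x))) = q (norm x) * g (u x) (v x))"
proof -
  define N where "N = CARD('n)"
  define P where "P t = p t ^ k + q t ^ k" for t
  define \<Phi> where "\<Phi> t = f t t ^ k + g t t ^ k" for t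
  have k1: "1 \<le> k" and kN: "k \<le> N" and N1: "1 \<le> N"
    using k N by (auto simp: N_def split: if_splits)
  have f_mono: "f s t \<le> f s' t'" if "0 \<le> s" "s \<le> s'" "0 \<le> t" "t \<le> t'" for s t s' t'
    using mono_onD [OF f_mono1, of t s s'] mono_onD [OF f_mono2, of s' t t'] that by simp
  have g_mono: "g s t \<le> g s' t'" if "0 \<le> s" "s \<le> s'" "0 \<le> t" "t \<le> t'" for s t s' t'
    using mono_onD [OF g_mono1, of t s s'] mono_onD [OF g_mono2, of s' t t'] that by simp
  have diag: "continuous_on {0..} (\<lambda>t::real. (t, t))" "(\<lambda>t::real. (t, t)) ` {0..} \<subseteq> {0..} \<times> {0..}"
    by (auto intro!: continuous_intros)
  have \<Phi>c: "continuous_on {0..} \<Phi>"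
    using continuous_on_compose2 [OF f_cont diag] continuous_on_compose2 [OF g_cont diag]
    unfolding \<Phi>_def by (auto intro!: continuous_intros)
  have \<Phi>pos: "\<Phi> t > 0" if "t > 0" for t
    using f_pos [OF that that] g_pos [OF that that] by (simp add: \<Phi>_def add_pos_pos)
  have F_int: "F t = integral {0..t} \<Phi>" if "t \<ge> 0" for t
    using F_def [OF that] by (simp add: \<Phi>_def [abs_def])
  have F_deriv: "(F has_real_derivative \<Phi> t) (at t)" and F_pos: "F t > 0" if "t > 0" for t
    using integral_from_0_deriv_pos [OF \<Phi>c \<Phi>pos F_int that] by auto
  have Pc: "continuous_on {0..} P"
    unfolding P_def by (intro continuous_intros p_cont q_cont)
  have Ppos: "P t > 0" if "t \<ge> 0" for t
    using p_pos [OF that] q_pos [OF that] by (simp add: P_def add_pos_pos)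
  obtain \<epsilon> where "\<epsilon> > 0" "(\<integral>\<^sup>+t\<in>{0..}. ennreal (t powr (1 + \<epsilon> + 2 * (real k - 1) / (real k + 1)) *
             P t powr (2 / (real k + 1))) \<partial>lborel) < \<infinity>"
    using weight_integrable unfolding P_def by blast
  from weight_integral_bounded [OF Pc Ppos k1 this]
  obtain L where L: "\<And>r. r \<ge> 0 \<Longrightarrow> integral {0..r} (\<lambda>t. root (k + 1) (t ^ (k - 1) * P t)) \<le> L"
    by blast
  obtain R where R: "R > 0" "mono_on {R..} (\<lambda>r. r powr (real N + real N / real k - 2) * P r)"
    using weight_mono unfolding P_def N_def by blast
  have "real N + real N / real k - 2 \<ge> 0"
  proof -
    have "real N / real k \<ge> 0" by simp
    moreover have "real N \<ge> 3" using N by (simp add: N_def)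
    ultimately show ?thesis by linarith
  qed
  from eventually_mono_imp_quasi_mono [OF Pc Ppos this R]
  obtain K where K: "K > 0" and W: "\<And>s r. 0 < s \<Longrightarrow> s \<le> r \<Longrightarrow>
      s powr (real N + real N / real k - 2) * P s \<le> K * (r powr (real N + real N / real k - 2) * P r)"
    by blast
  define \<phi> where "\<phi> t = 1 / root (k + 1) (real (k + 1) * F t)" for t
  have "continuous_on {1..} F"
    by (rule DERIV_continuous_on, rule has_field_derivative_at_within, rule F_deriv) auto
  moreover have root_pos: "root (k + 1) (real (k + 1) * F t) > 0" if "t > 0" for t
    using F_pos [OF that] by simp
  ultimately have "continuous_on {1..} \<phi>"
    unfolding \<phi>_def by (intro continuous_intros) (force simp: less_le)+
  moreover have "\<phi> t \<ge> 0" if "t \<ge> 1" for t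
    using root_pos [of t] that by (simp add: \<phi>_def)
  \<comment> \<open>\<open>M\<close> depends only on \<open>K\<close>, \<open>L\<close>,
    \<open>F\<close>, \<open>N\<close> and \<open>k\<close>, so it bounds every iterate at every
    radius. The lower limit \<open>1\<close> is the sum \<open>1/2 + 1/2\<close> of the central
    values.\<close>
  ultimately obtain M where M: "M \<ge> 1"
      "2 * root (k + 1) (K / real ((N - 1) choose (k - 1))) * L < integral {1..M} \<phi>"
    using nn_integral_infinite_imp_integral_unbounded [of 1 \<phi>] keller_osserman unfolding \<phi>_def by blast
  let ?y = "\<lambda>u v t. (p t * f (u t) (v t)) ^ k" and ?z = "\<lambda>u v t. (q t * g (u t) (v t)) ^ k"
  \<comment> \<open>The initial value \<open>1/2\<close> keeps both arguments strictly positive, so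
    the right-hand sides are positive, as admissibility requires.\<close>
  have rhs: "continuous_on {0..} (?y u v)" "continuous_on {0..} (?z u v)"
      "\<And>t. t \<ge> 0 \<Longrightarrow> ?y u v t > 0" "\<And>t. t \<ge> 0 \<Longrightarrow> ?z u v t > 0"
    if c: "continuous_on {0..} u" "continuous_on {0..} v"
      and ge: "\<And>t. t \<ge> 0 \<Longrightarrow> 1/2 \<le> u t" "\<And>t. t \<ge> 0 \<Longrightarrow> 1/2 \<le> v t" for u v
  proof -
    have pos: "0 < u t" "0 < v t" if "t \<ge> 0" for t
      using ge [OF that] by linarith+
    then have pair: "continuous_on {0..} (\<lambda>t. (u t, v t))" "(\<lambda>t. (u t, v t)) ` {0..} \<subseteq> {0..} \<times> {0..}"
      by (auto intro!: continuous_intros c simp: less_imp_le)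
    show "continuous_on {0..} (?y u v)" "continuous_on {0..} (?z u v)"
      using continuous_on_compose2 [OF f_cont pair] continuous_on_compose2 [OF g_cont pair]
      by (auto intro!: continuous_intros p_cont q_cont)
    show "?y u v t > 0" "?z u v t > 0" if "t \<ge> 0" for t
      using p_pos [OF that] q_pos [OF that] f_pos [OF pos [OF that]] g_pos [OF pos [OF that]] by simp_all
  qed
  have bound: "profile N k (1/2) (?y u v) r + profile N k (1/2) (?z u v) r \<le> M"
    if c: "continuous_on {0..} u" "continuous_on {0..} v"
      and u: "\<And>t. t \<ge> 0 \<Longrightarrow> 1/2 \<le> u t \<and> u t \<le> profile N k (1/2) (?y u v) t"
      and v: "\<And>t. t \<ge> 0 \<Longrightarrow> 1/2 \<le> v t \<and> v t \<le> profile N k (1/2) (?z u v) t"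
      and r: "r \<ge> 0" for u v r
  proof -
    note rhs' = rhs [OF c conjunct1 [OF u] conjunct1 [OF v]]
    have le: "?y u v t \<le> P t * \<Phi> (profile N k (1/2) (?y u v) t + profile N k (1/2) (?z u v) t)"
      "?z u v t \<le> P t * \<Phi> (profile N k (1/2) (?y u v) t + profile N k (1/2) (?z u v) t)"
      if t: "t > 0" for t
    proof -
      let ?w = "profile N k (1/2) (?y u v) t + profile N k (1/2) (?z u v) t"
      \<comment> \<open>A subsolution lies below its profile and the other profile is nonnegative,
        so both components are at most \<open>?w\<close>; monotonicity then moves \<open>f\<close>
        and \<open>g\<close> to the diagonal, where \<open>\<Phi>\<close> dominates their
        powers.\<close>
      have uv: "0 \<le> u t" "0 \<le> v t" "u t \<le> ?w" "v t \<le> ?w"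
        using u [of t] v [of t] t by auto
      have pq: "0 \<le> p t" "0 \<le> q t"
        using p_pos [of t] q_pos [of t] t by auto
      have w: "0 \<le> f ?w ?w" "0 \<le> g ?w ?w"
        using f_nonneg [of ?w ?w] g_nonneg [of ?w ?w] uv by auto
      have "f (u t) (v t) ^ k \<le> f ?w ?w ^ k" "g (u t) (v t) ^ k \<le> g ?w ?w ^ k"
        using f_mono [OF uv(1,3) uv(2,4)] g_mono [OF uv(1,3) uv(2,4)] f_nonneg [OF uv(1,2)] g_nonneg [OF uv(1,2)]
        by (auto intro: power_mono)
      then have "f (u t) (v t) ^ k \<le> \<Phi> ?w" "g (u t) (v t) ^ k \<le> \<Phi> ?w"
        using w by (auto simp: \<Phi>_def add_increasing add_increasing2)
      moreover have "p t ^ k \<le> P t" "q t ^ k \<le> P t"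
        using pq by (auto simp: P_def)
      ultimately show "?y u v t \<le> P t * \<Phi> ?w" "?z u v t \<le> P t * \<Phi> ?w"
        unfolding power_mult_distrib using f_nonneg [OF uv(1,2)] g_nonneg [OF uv(1,2)] Ppos [of t] t
        by (auto intro!: mult_mono)
    qed
    show ?thesis
    proof (rule profile_sum_bounded [OF k1 kN rhs'(1,3) rhs'(2,4) F_deriv F_pos])
      show "2 * root (k + 1) (K / real ((N - 1) choose (k - 1))) * L
          < integral {1/2 + 1/2..M} (\<lambda>t. 1 / root (k + 1) (real (k + 1) * F t))"
        using M(2) unfolding \<phi>_def [abs_def] by simp
    qed (use le Pc W K L M(1) r in \<open>auto intro: less_imp_le [OF \<Phi>pos]\<close>)
  qed
  have half: "(1/2 :: real) \<ge> 0" by simp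
  obtain u v where uv_cont: "continuous_on {0..} u" "continuous_on {0..} v"
    and u: "\<And>r. r \<ge> 0 \<Longrightarrow> 1/2 \<le> u r \<and> u r \<le> M" "\<And>r. r \<ge> 0 \<Longrightarrow> u r = profile N k (1/2) (?y u v) r"
    and v: "\<And>r. r \<ge> 0 \<Longrightarrow> 1/2 \<le> v r \<and> v r \<le> M" "\<And>r. r \<ge> 0 \<Longrightarrow> v r = profile N k (1/2) (?z u v) r"
  proof (rule radial_system_solution [where a = "1/2" and b = "1/2" and M = M,
        OF k1 N1 half half p_cont less_imp_le [OF p_pos] q_cont less_imp_le [OF q_pos]
          f_cont f_nonneg g_cont g_nonneg f_mono g_mono])
    fix u v :: "real \<Rightarrow> real" and r :: real
    assume "continuous_on {0..} u" "continuous_on {0..} v"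
      "\<And>t. t \<ge> 0 \<Longrightarrow> 1/2 \<le> u t \<and> u t \<le> profile N k (1/2) (?y u v) t"
      "\<And>t. t \<ge> 0 \<Longrightarrow> 1/2 \<le> v t \<and> v t \<le> profile N k (1/2) (?z u v) t" "r \<ge> 0"
    then show "profile N k (1/2) (?y u v) r + profile N k (1/2) (?z u v) r \<le> M"
      by (rule bound [where u = u and v = v and r = r])
  next
    fix u v :: "real \<Rightarrow> real"
    assume c: "continuous_on {0..} u" "continuous_on {0..} v"
      and b: "\<And>r. r \<ge> 0 \<Longrightarrow> 1/2 \<le> u r \<and> u r \<le> M" "\<And>r. r \<ge> 0 \<Longrightarrow> 1/2 \<le> v r \<and> v r \<le> M"
      and e: "\<And>r. r \<ge> 0 \<Longrightarrow> u r = profile N k (1/2) (?y u v) r"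
        "\<And>r. r \<ge> 0 \<Longrightarrow> v r = profile N k (1/2) (?z u v) r"
    show thesis
      by (rule that [OF c b(1) e(1) b(2) e(2)])
  qed assumption+
  have uv_ge: "1/2 \<le> u t" "1/2 \<le> v t" if "t \<ge> 0" for t
    using u(1) [OF that] v(1) [OF that] by auto
  define u' where "u' x = u (norm x)" for x :: "real^'n"
  define v' where "v' x = v (norm x)" for x :: "real^'n"
  have u': "u' = (\<lambda>x. profile CARD('n) k (1/2) (?y u v) (norm x))"
    using u(2) unfolding u'_def N_def by auto
  have v': "v' = (\<lambda>x. profile CARD('n) k (1/2) (?z u v) (norm x))"
    using v(2) unfolding v'_def N_def by auto
  have sol_u: "u' \<in> admissible k" "elem_sym k (eigenvalues (hessian u' x)) = ?y u v (norm x)" for x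
    unfolding u' using rhs(1,3) [OF uv_cont uv_ge] k1 kN
    by (auto intro!: radial_solution [where z = "?y u v"] simp: N_def)
  have sol_v: "v' \<in> admissible k" "elem_sym k (eigenvalues (hessian v' x)) = ?z u v (norm x)" for x
    unfolding v' using rhs(2,4) [OF uv_cont uv_ge] k1 kN
    by (auto intro!: radial_solution [where z = "?z u v"] simp: N_def)
  have nonneg: "0 \<le> u' x" "0 \<le> v' x" "u' x \<le> M" "v' x \<le> M" for x
    using u(1) [of "norm x"] v(1) [of "norm x"] by (auto simp: u'_def v'_def)
  show ?thesis
  proof (intro exI conjI allI)
    show "u' \<in> admissible k"
      by (rule sol_u(1))
    show "v' \<in> admissible k"
      by (rule sol_v(1))
    show "radial u'" "radial v'"
      unfolding radial_def u'_def v'_def by blast+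
    show "0 \<le> u' x" "0 \<le> v' x" for x
      by (rule nonneg)+
    show "bounded (range u')" "bounded (range v')"
      unfolding bounded_iff using nonneg by (auto intro!: exI [of _ M])
    \<comment> \<open>Nontriviality is witnessed at the origin, where \<open>u\<close> is at least
      \<open>1/2\<close>.\<close>
    show "(u' 0, v' 0) \<noteq> (0, 0)"
      using u(1) [of 0] by (auto simp: u'_def)
    show "root k (elem_sym k (eigenvalues (hessian u' x))) = p (norm x) * f (u' x) (v' x)" for x
      unfolding sol_u(2) using k1 p_pos [of "norm x"] f_nonneg [OF nonneg(1,2)]
      by (simp add: real_root_power_cancel u'_def v'_def)
    show "root k (elem_sym k (eigenvalues (hessian v' x))) = q (norm x) * g (u' x) (v' x)" for x
      unfolding sol_v(2) using k1 q_pos [of "norm x"] g_nonneg [OF nonneg(1,2)]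
      by (simp add: real_root_power_cancel u'_def v'_def)
  qed
qed

end
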